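(* Let $H$ be an infinite-dimensional separable complex Hilbert space. Let $\Lambda\subseteq[0,\infty)$ be a bounded countable set, well-ordered by the usual order of $\mathbb{R}$, and let $(P_\lambda)_{\lambda\in\Lambda}$ be mutually orthogonal projections on $H$ with $\sum_{\lambda\in\Lambda}P_\lambda=I$ in the strong operator topology. Let $F\in\mathcal{B}(H)$ be a self-adjoint finite rank operator and let $K\in\mathcal{B}(H)$ be a positive compact operator such that $FP_\lambda=P_\lambda F$ and $KP_\lambda=P_\lambda K$ for all $\lambda\in\Lambda$. Assume that $K|_{R(P_\lambda)}\le\lambda I_{R(P_\lambda)}$ for all $\lambda\in\Lambda$. If $$T:=\sum_{\lambda\in\Lambda}\lambda P_\lambda+F-K$$ (series in the strong operator topology) is positive, then $T\in\mathcal{M}_r(H)$.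
   Context: $\mathcal{B}(H)$ denotes the bounded linear operators on $H$; $R(P)$ is the range of $P$; projections are orthogonal projections; for self-adjoint $A,B$, $A\le B$ means $B-A$ is positive, i.e. $\langle (B-A)x,x\rangle\ge0$ for all $x$. For a nonzero Hilbert space $M$ and $A\in\mathcal{B}(M)$, the minimum modulus is $m(A)=\inf\{\|Ax\|: x\in M,\ \|x\|=1\}$; $A$ is minimum attaining if there is a unit vector $x_0\in M$ with $\|Ax_0\|=m(A)$. A closed subspace $M\subseteq H$ reduces $T\in\mathcal{B}(H)$ if $T(M)\subseteq M$ and $T^*(M)\subseteq M$. $\mathcal{M}_r(H)$ is the set of all $T\in\mathcal{B}(H)$ such that for every nonzero closed subspace $M$ reducing $T$, the restriction $T|_M:M\to M$ is minimum attaining. *)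

theory Defs
  imports "HOL-Analysis.Analysis"
begin

subsection \<open>Complex Hilbert spaces\<close>

class complex_vector = real_vector +
  fixes scaleC :: "complex \<Rightarrow> 'a \<Rightarrow> 'a"  (infixr \<open>*\<^sub>C\<close> 75)
  assumes scaleC_add_right: "a *\<^sub>C (x + y) = a *\<^sub>C x + a *\<^sub>C y"
    and scaleC_add_left: "(a + b) *\<^sub>C x = a *\<^sub>C x + b *\<^sub>C x"
    and scaleC_scaleC: "a *\<^sub>C b *\<^sub>C x = (a * b) *\<^sub>C x"
    and scaleC_one: "1 *\<^sub>C x = x"
    and scaleR_scaleC: "r *\<^sub>R x = complex_of_real r *\<^sub>C x"

global_interpretation complex_vector: vector_space "scaleC :: complex \<Rightarrow> 'a \<Rightarrow> 'a::complex_vector"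
  by unfold_locales (simp_all add: scaleC_add_right scaleC_add_left scaleC_scaleC scaleC_one)

text \<open>The inner product is linear in the first and conjugate-linear in the second argument.
  Positive definiteness is part of \<open>norm_eq_sqrt_cinner\<close> together with the norm axioms.\<close>

class complex_inner = complex_vector + real_normed_vector +
  fixes cinner :: "'a \<Rightarrow> 'a \<Rightarrow> complex"
  assumes cinner_commute: "cinner x y = cnj (cinner y x)"
    and cinner_add_left: "cinner (x + y) z = cinner x z + cinner y z"
    and cinner_scaleC_left: "cinner (a *\<^sub>C x) y = a * cinner x y"
    and norm_eq_sqrt_cinner: "norm x = sqrt (Re (cinner x x))"

class complex_hilbert_space = complex_inner + complete_space

definition finite_dim :: "'a::complex_vector set \<Rightarrow> bool" where
  "finite_dim V \<longleftrightarrow> (\<exists>B. finite B \<and> complex_vector.span B = V)"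

subsection \<open>Operators\<close>

text \<open>Operators are total functions; \<open>bounded_clinear A\<close> says that \<open>A\<close> belongs to B(H).\<close>

definition bounded_clinear :: "('a::complex_inner \<Rightarrow> 'a) \<Rightarrow> bool" where
  "bounded_clinear A \<longleftrightarrow>
     Vector_Spaces.linear scaleC scaleC A \<and> (\<exists>C. \<forall>x. norm (A x) \<le> C * norm x)"

definition is_adjoint :: "('a::complex_inner \<Rightarrow> 'a) \<Rightarrow> ('a \<Rightarrow> 'a) \<Rightarrow> bool" where
  "is_adjoint A B \<longleftrightarrow> (\<forall>x y. cinner (A x) y = cinner x (B y))"

text \<open>For \<open>bounded_clinear A\<close> on a Hilbert space the adjoint exists by the Riesz
  representation theorem; uniqueness is shown in \<open>cadjoint_eqI\<close> below.\<close>

definition cadjoint :: "('a::complex_inner \<Rightarrow> 'a) \<Rightarrow> ('a \<Rightarrow> 'a)" where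
  "cadjoint A = (THE B. is_adjoint A B)"

definition self_adjoint :: "('a::complex_inner \<Rightarrow> 'a) \<Rightarrow> bool" where
  "self_adjoint A \<longleftrightarrow> is_adjoint A A"

definition orth_projection :: "('a::complex_inner \<Rightarrow> 'a) \<Rightarrow> bool" where
  "orth_projection P \<longleftrightarrow> bounded_clinear P \<and> self_adjoint P \<and> (\<forall>x. P (P x) = P x)"

text \<open>\<open>\<real>\<^sub>\<ge>\<^sub>0\<close> is the set of complex numbers that are real and nonnegative.\<close>

definition op_le_on :: "'a::complex_inner set \<Rightarrow> ('a \<Rightarrow> 'a) \<Rightarrow> ('a \<Rightarrow> 'a) \<Rightarrow> bool" where
  "op_le_on M A B \<longleftrightarrow> (\<forall>x\<in>M. cinner (B x - A x) x \<in> \<real>\<^sub>\<ge>\<^sub>0)"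

definition positive_op :: "('a::complex_inner \<Rightarrow> 'a) \<Rightarrow> bool" where
  "positive_op A \<longleftrightarrow> (\<forall>x. cinner (A x) x \<in> \<real>\<^sub>\<ge>\<^sub>0)"

definition finite_rank :: "('a::complex_inner \<Rightarrow> 'a) \<Rightarrow> bool" where
  "finite_rank A \<longleftrightarrow> finite_dim (range A)"

definition compact_op :: "('a::complex_inner \<Rightarrow> 'a) \<Rightarrow> bool" where
  "compact_op A \<longleftrightarrow> bounded_clinear A \<and> compact (closure (A ` cball 0 1))"

text \<open>Convergence in the strong operator topology, as the limit of the net of finite partial
  sums.\<close>

definition has_sot_sum :: "('i \<Rightarrow> 'a::complex_inner \<Rightarrow> 'a) \<Rightarrow> 'i set \<Rightarrow> ('a \<Rightarrow> 'a) \<Rightarrow> bool" where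
  "has_sot_sum A I S \<longleftrightarrow> (\<forall>x. ((\<lambda>i. A i x) has_sum S x) I)"

definition sot_sum :: "('i \<Rightarrow> 'a::complex_inner \<Rightarrow> 'a) \<Rightarrow> 'i set \<Rightarrow> ('a \<Rightarrow> 'a)" where
  "sot_sum A I = (\<lambda>x. \<Sum>\<^sub>\<infinity>i\<in>I. A i x)"

subsection \<open>Minimum attaining operators\<close>

text \<open>The second argument \<open>M\<close> is a subspace; these are the notions for the restriction of \<open>A\<close>
  to \<open>M\<close>.\<close>

definition min_modulus :: "('a::complex_inner \<Rightarrow> 'a) \<Rightarrow> 'a set \<Rightarrow> real" where
  "min_modulus A M = (INF x\<in>{x\<in>M. norm x = 1}. norm (A x))"

definition minimum_attaining :: "('a::complex_inner \<Rightarrow> 'a) \<Rightarrow> 'a set \<Rightarrow> bool" where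
  "minimum_attaining A M \<longleftrightarrow> (\<exists>x\<in>M. norm x = 1 \<and> norm (A x) = min_modulus A M)"

definition reduces :: "'a::complex_inner set \<Rightarrow> ('a \<Rightarrow> 'a) \<Rightarrow> bool" where
  "reduces M T \<longleftrightarrow> complex_vector.subspace M \<and> closed M \<and> T ` M \<subseteq> M \<and> cadjoint T ` M \<subseteq> M"

definition Mr :: "('a::complex_hilbert_space \<Rightarrow> 'a) set" where
  "Mr = {T. bounded_clinear T \<and> (\<forall>M. M \<noteq> {0} \<and> reduces M T \<longrightarrow> minimum_attaining T M)}"

subsection \<open>Well-definedness of the adjoint and of the operator series\<close>

lemma cinner_add_right: "cinner x (y + z) = cinner x y + cinner (x::'a::complex_inner) z"
  by (metis cinner_add_left cinner_commute complex_cnj_add)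

lemma cinner_zero_left [simp]: "cinner 0 (y::'a::complex_inner) = 0"
  using cinner_add_left[of 0 0 y] by simp

lemma cinner_zero_right [simp]: "cinner (y::'a::complex_inner) 0 = 0"
  using cinner_add_right[of y 0 0] by simp

lemma cinner_minus_right: "cinner (x::'a::complex_inner) (y - z) = cinner x y - cinner x z"
  using cinner_add_right[of x "y - z" z] by simp

lemma cinner_self_eq_0: "cinner x x = 0 \<Longrightarrow> (x::'a::complex_inner) = 0"
  using norm_eq_sqrt_cinner[of x] by simp

lemma cadjoint_eqI:
  assumes "is_adjoint A B"
  shows "cadjoint A = B"
  unfolding cadjoint_def
proof (rule the_equality)
  fix C assume C: "is_adjoint A C"
  show "C = B"
  proof
    fix y
    have "cinner x (C y - B y) = 0" for x
      using assms C unfolding is_adjoint_def cinner_minus_right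
      by (metis right_minus_eq)
    then show "C y = B y"
      using cinner_self_eq_0 by (metis eq_iff_diff_eq_0)
  qed
qed (fact assms)

lemma norm_power2_cinner: "(norm (x::'a::complex_inner))\<^sup>2 = Re (cinner x x)"
proof -
  have "0 \<le> sqrt (Re (cinner x x))"
    by (metis norm_eq_sqrt_cinner norm_ge_zero)
  then show ?thesis
    by (simp add: norm_eq_sqrt_cinner)
qed

lemma norm_power2_add_orthogonal:
  assumes "cinner x y = 0"
  shows "(norm (x + y))\<^sup>2 = (norm x)\<^sup>2 + (norm (y::'a::complex_inner))\<^sup>2"
proof -
  have "cinner y x = 0"
    using assms by (metis cinner_commute complex_cnj_zero)
  then show ?thesis
    using assms by (simp add: norm_power2_cinner cinner_add_left cinner_add_right)
qed

lemma cinner_sum_right: "cinner (x::'a::complex_inner) (\<Sum>i\<in>A. f i) = (\<Sum>i\<in>A. cinner x (f i))"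
  by (induction A rule: infinite_finite_induct) (simp_all add: cinner_add_right)

lemma norm_power2_sum_orthogonal:
  fixes v :: "'i \<Rightarrow> 'a::complex_inner"
  assumes "finite A" and "\<And>i j. i \<in> A \<Longrightarrow> j \<in> A \<Longrightarrow> i \<noteq> j \<Longrightarrow> cinner (v i) (v j) = 0"
  shows "(norm (\<Sum>i\<in>A. v i))\<^sup>2 = (\<Sum>i\<in>A. (norm (v i))\<^sup>2)"
  using assms
proof (induction A rule: finite_induct)
  case (insert i A)
  have "cinner (v i) (\<Sum>j\<in>A. v j) = 0"
    unfolding cinner_sum_right using insert.hyps insert.prems by (intro sum.neutral) auto
  with insert show ?case
    by (simp add: norm_power2_add_orthogonal)
qed simp

lemma has_sum_finite_tail:
  fixes f :: "'i \<Rightarrow> 'a::real_normed_vector"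
  assumes "f summable_on I" and "e > 0"
  shows "\<exists>A. finite A \<and> A \<subseteq> I \<and> (\<forall>B. finite B \<and> B \<subseteq> I - A \<longrightarrow> norm (sum f B) < e)"
proof -
  obtain s where "(sum f \<longlongrightarrow> s) (finite_subsets_at_top I)"
    using assms(1) by (auto simp: summable_on_def has_sum_def)
  then have "eventually (\<lambda>F. dist (sum f F) s < e / 2) (finite_subsets_at_top I)"
    using \<open>e > 0\<close> unfolding tendsto_iff by (metis half_gt_zero)
  then obtain A where A: "finite A" "A \<subseteq> I"
    and s: "\<And>F. finite F \<Longrightarrow> A \<subseteq> F \<Longrightarrow> F \<subseteq> I \<Longrightarrow> dist (sum f F) s < e / 2"
    by (auto simp: eventually_finite_subsets_at_top)
  have "norm (sum f B) < e" if B: "finite B" "B \<subseteq> I - A" for B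
  proof -
    have "sum f (A \<union> B) = sum f A + sum f B"
      using A B by (intro sum.union_disjoint) auto
    then have "norm (sum f B) = dist (sum f (A \<union> B)) (sum f A)"
      by (simp add: dist_norm)
    also have "\<dots> < e"
      using s[of "A \<union> B"] s[of A] A B dist_triangle_half_l[of "sum f (A \<union> B)" s e "sum f A"]
      by auto
    finally show ?thesis .
  qed
  with A show ?thesis by blast
qed

lemma summable_on_tailI:
  fixes f :: "'i \<Rightarrow> 'a::{real_normed_vector, complete_space}"
  assumes "\<And>e. e > 0 \<Longrightarrow>
    \<exists>A. finite A \<and> A \<subseteq> I \<and> (\<forall>B. finite B \<and> B \<subseteq> I - A \<longrightarrow> norm (sum f B) < e)"
  shows "f summable_on I"
proof -
  have "\<exists>P. eventually P (finite_subsets_at_top I) \<and>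
          (\<forall>F F'. P F \<and> P F' \<longrightarrow> dist (sum f F) (sum f F') < e)" if "e > 0" for e
  proof -
    obtain A where A: "finite A" "A \<subseteq> I"
      and tail: "\<And>B. finite B \<Longrightarrow> B \<subseteq> I - A \<Longrightarrow> norm (sum f B) < e / 2"
      using assms[of "e / 2"] \<open>e > 0\<close> by auto
    define P where "P F \<longleftrightarrow> finite F \<and> A \<subseteq> F \<and> F \<subseteq> I" for F
    have near: "dist (sum f F) (sum f A) < e / 2" if "P F" for F
      using that tail[of "F - A"] by (auto simp: P_def dist_norm sum_diff)
    have "eventually P (finite_subsets_at_top I)"
      unfolding P_def eventually_finite_subsets_at_top using A by auto
    moreover have "dist (sum f F) (sum f F') < e" if "P F" "P F'" for F F'
      using near[OF that(1)] near[OF that(2)] by (rule dist_triangle_half_l)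
    ultimately show ?thesis by blast
  qed
  then have "cauchy_filter (filtermap (sum f) (finite_subsets_at_top I))"
    by (simp add: cauchy_filter_metric_filtermap)
  moreover have "complete (UNIV :: 'a set)"
    by (meson Cauchy_convergent UNIV_I complete_def convergent_def)
  ultimately obtain L where "(sum f \<longlongrightarrow> L) (finite_subsets_at_top I)"
    using complete_uniform[where S = UNIV] by (force simp: filterlim_def)
  then show ?thesis
    by (auto simp: summable_on_def has_sum_def)
qed

lemma cinner_scaleR_left: "cinner (r *\<^sub>R x) (y::'a::complex_inner) = of_real r * cinner x y"
  by (simp add: scaleR_scaleC cinner_scaleC_left)

lemma cinner_scaleR_right: "cinner x (r *\<^sub>R (y::'a::complex_inner)) = of_real r * cinner x y"
  by (metis cinner_commute cinner_scaleR_left complex_cnj_complex_of_real complex_cnj_mult)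

lemma has_sot_sum_scaled_projections:
  fixes P :: "real \<Rightarrow> 'a::complex_hilbert_space \<Rightarrow> 'a"
  assumes "bounded \<Lambda>"
    and proj: "\<And>l. l \<in> \<Lambda> \<Longrightarrow> orth_projection (P l)"
    and orth: "\<And>l m x. l \<in> \<Lambda> \<Longrightarrow> m \<in> \<Lambda> \<Longrightarrow> l \<noteq> m \<Longrightarrow> P l (P m x) = 0"
    and id: "has_sot_sum P \<Lambda> (\<lambda>x. x)"
  shows "has_sot_sum (\<lambda>l x. l *\<^sub>R P l x) \<Lambda> (sot_sum (\<lambda>l x. l *\<^sub>R P l x) \<Lambda>)"
proof -
  obtain b where b: "b > 0" "\<And>l. l \<in> \<Lambda> \<Longrightarrow> \<bar>l\<bar> \<le> b"
    using \<open>bounded \<Lambda>\<close> by (auto simp: bounded_pos)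
  have orth': "cinner (P l x) (P m x) = 0" if "l \<in> \<Lambda>" "m \<in> \<Lambda>" "l \<noteq> m" for l m x
    using proj[OF that(1)] orth[OF that]
    by (simp add: orth_projection_def self_adjoint_def is_adjoint_def)
  have "(\<lambda>l. l *\<^sub>R P l x) summable_on \<Lambda>" for x
  proof (rule summable_on_tailI)
    fix e :: real assume "e > 0"
    have "(\<lambda>l. P l x) summable_on \<Lambda>"
      using id by (auto simp: has_sot_sum_def summable_on_def)
    then obtain A where A: "finite A" "A \<subseteq> \<Lambda>"
      and tail: "\<And>B. finite B \<Longrightarrow> B \<subseteq> \<Lambda> - A \<Longrightarrow> norm (\<Sum>l\<in>B. P l x) < e / b"
      using has_sum_finite_tail[of "\<lambda>l. P l x" \<Lambda> "e / b"] \<open>e > 0\<close> b by auto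
    have "norm (\<Sum>l\<in>B. l *\<^sub>R P l x) < e" if B: "finite B" "B \<subseteq> \<Lambda> - A" for B
    proof -
      have orthB: "cinner (P l x) (P m x) = 0" if "l \<in> B" "m \<in> B" "l \<noteq> m" for l m
        using that B by (intro orth') auto
      have "(norm (\<Sum>l\<in>B. l *\<^sub>R P l x))\<^sup>2 = (\<Sum>l\<in>B. (norm (l *\<^sub>R P l x))\<^sup>2)"
        using B orthB
        by (intro norm_power2_sum_orthogonal) (auto simp: cinner_scaleR_left cinner_scaleR_right)
      also have "\<dots> \<le> (\<Sum>l\<in>B. b\<^sup>2 * (norm (P l x))\<^sup>2)"
      proof (rule sum_mono)
        fix l assume "l \<in> B"
        then have "\<bar>l\<bar> * norm (P l x) \<le> b * norm (P l x)"
          using b B by (intro mult_right_mono) auto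
        then have "(\<bar>l\<bar> * norm (P l x))\<^sup>2 \<le> (b * norm (P l x))\<^sup>2"
          by (intro power_mono) auto
        then show "(norm (l *\<^sub>R P l x))\<^sup>2 \<le> b\<^sup>2 * (norm (P l x))\<^sup>2"
          by (simp add: power_mult_distrib)
      qed
      also have "\<dots> = b\<^sup>2 * (norm (\<Sum>l\<in>B. P l x))\<^sup>2"
        using norm_power2_sum_orthogonal[OF B(1), of "\<lambda>l. P l x"] orthB
        by (simp add: sum_distrib_left)
      also have "\<dots> = (b * norm (\<Sum>l\<in>B. P l x))\<^sup>2"
        by (simp add: power_mult_distrib)
      finally have "norm (\<Sum>l\<in>B. l *\<^sub>R P l x) \<le> b * norm (\<Sum>l\<in>B. P l x)"
        by (rule power2_le_imp_le) (use b in simp)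
      also have "\<dots> < e"
        using tail[OF B] b by (simp add: field_simps)
      finally show ?thesis .
    qed
    with A show "\<exists>A. finite A \<and> A \<subseteq> \<Lambda> \<and>
        (\<forall>B. finite B \<and> B \<subseteq> \<Lambda> - A \<longrightarrow> norm (\<Sum>l\<in>B. l *\<^sub>R P l x) < e)"
      by blast
  qed
  then show ?thesis
    by (auto simp: has_sot_sum_def sot_sum_def)
qed

end

theory Submission
  imports Defs
begin

text \<open>Let \<open>M\<close> reduce \<open>T\<close> and let \<open>\<mu>\<close> be the infimum of \<open>\<langle>T x, x\<rangle>\<close> over the unit vectors of \<open>M\<close>; it
  suffices to find an eigenvector for \<open>\<mu>\<close> in \<open>M\<close>. The spectrum of \<open>T\<close> has a gap just above any real
  \<open>\<mu>\<close>: where \<open>\<lambda> \<le> \<mu>\<close>, the operator \<open>S = T - \<mu>\<close> is at most \<open>F\<close>, which has finite rank; where \<open>\<lambda> > \<mu>\<close>,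
  well-ordering bounds \<open>\<lambda> - \<mu>\<close> below by some \<open>\<delta> > 0\<close>, so \<open>S\<close> is a compact perturbation of an operator
  that is at least \<open>\<delta>\<close>. To avoid the spectral theorem, the gap is expressed as
  \<open>\<langle>S x, x\<rangle> \<le> C \<parallel>S x\<parallel>\<^sup>2\<close>, meaning that \<open>S\<close> has no spectrum in \<open>(0, 1/C)\<close>. On \<open>M\<close>, where \<open>S \<ge> 0\<close>, the
  gap makes the iteration \<open>x \<mapsto> x - S x / L\<close> converge geometrically to a kernel vector of \<open>S\<close>, which
  is nonzero if the starting unit vector nearly minimises \<open>\<langle>S x, x\<rangle>\<close>.\<close>

subsection \<open>The underlying real inner product\<close>

instance complex_hilbert_space \<subseteq> banach ..

text \<open>Real part of \<open>cinner\<close>. It makes H a real inner product space, to which the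
  real-linear notions \<open>subspace\<close>, \<open>linear\<close> and
  \<open>bounded_bilinear\<close> apply directly, and inequalities between forms become inequalities
  of reals.\<close>

definition rinner :: "'a::complex_inner \<Rightarrow> 'a \<Rightarrow> real" where
  "rinner x y = Re (cinner x y)"

lemma rinner_commute: "rinner x y = rinner y x"
  unfolding rinner_def by (subst cinner_commute) simp

lemma rinner_self: "rinner x x = (norm x)\<^sup>2"
  by (simp add: rinner_def norm_power2_cinner)

lemma rinner_add_left: "rinner (x + y) z = rinner x z + rinner y z"
  by (simp add: rinner_def cinner_add_left)

lemma rinner_scaleR_left: "rinner (r *\<^sub>R x) y = r * rinner x y"
  by (simp add: rinner_def cinner_scaleR_left)

text \<open>Cauchy-Schwarz follows from the norm axioms: squaring the triangle inequality for
  \<open>x + y\<close> and cancelling the two squares leaves it.\<close>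

lemma rinner_le_norm: "rinner x y \<le> norm x * norm y"
proof -
  have "(norm (x + y))\<^sup>2 \<le> (norm x + norm y)\<^sup>2"
    by (intro power_mono norm_triangle_ineq) simp
  moreover have "rinner (x + y) (x + y) = rinner x x + 2 * rinner x y + rinner y y"
    using rinner_commute[of x "x + y"] rinner_commute[of y "x + y"] rinner_commute[of y x]
    by (simp add: rinner_add_left)
  ultimately show ?thesis
    by (simp add: rinner_self power2_sum)
qed

lemma bounded_bilinear_rinner: "bounded_bilinear rinner"
proof
  fix x y z :: 'a and r :: real
  show "rinner (x + y) z = rinner x z + rinner y z" by (rule rinner_add_left)
  show "rinner x (y + z) = rinner x y + rinner x z"
    unfolding rinner_commute[of x] by (rule rinner_add_left)
  show "rinner (r *\<^sub>R x) y = r *\<^sub>R rinner x y" by (simp add: rinner_scaleR_left)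
  show "rinner x (r *\<^sub>R y) = r *\<^sub>R rinner x y"
    unfolding rinner_commute[of x] by (simp add: rinner_scaleR_left)
next
  have "\<bar>rinner x y\<bar> \<le> norm x * norm y" for x y :: 'a
    using rinner_le_norm[of x y] rinner_le_norm[of "- x" y] rinner_scaleR_left[of "-1" x y]
    by simp
  then show "\<exists>C. \<forall>x y :: 'a. norm (rinner x y) \<le> norm x * norm y * C"
    by (intro exI[of _ 1]) simp
qed

interpretation rinner: bounded_bilinear rinner
  by (rule bounded_bilinear_rinner)

lemmas rinner_algebra = rinner.add_left rinner.add_right rinner.diff_left rinner.diff_right
  rinner.scaleR_left rinner.scaleR_right rinner_self

lemma cinner_scaleC_right: "cinner x (c *\<^sub>C y) = cnj c * cinner x (y::'a::complex_inner)"
  by (subst (1 2) cinner_commute) (simp add: cinner_scaleC_left)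

lemma norm_scaleC: "norm (c *\<^sub>C x) = cmod c * norm (x::'a::complex_inner)"
proof (rule power2_eq_imp_eq)
  have "cinner (c *\<^sub>C x) (c *\<^sub>C x) = of_real ((cmod c)\<^sup>2) * cinner x x"
    unfolding complex_norm_square by (simp add: cinner_scaleC_left cinner_scaleC_right)
  then show "(norm (c *\<^sub>C x))\<^sup>2 = (cmod c * norm x)\<^sup>2"
    by (simp add: norm_power2_cinner power_mult_distrib)
qed simp_all

section \<open>Bounded, positive and finite rank operators\<close>

lemma bounded_clinear_imp_bounded_linear:
  assumes "bounded_clinear A"
  shows "bounded_linear A"
proof -
  from assms interpret Vector_Spaces.linear scaleC scaleC A
    by (simp add: bounded_clinear_def)
  obtain C where "\<And>x. norm (A x) \<le> C * norm x"
    using assms by (auto simp: bounded_clinear_def)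
  then show ?thesis
    by (intro bounded_linear_intro[of A C]) (auto simp: add scale scaleR_scaleC mult.commute)
qed

lemma positive_op_nonneg: "positive_op A \<Longrightarrow> 0 \<le> rinner (A x) x"
  by (auto simp: positive_op_def rinner_def complex_nonneg_Reals_iff)

text \<open>Polarization over the complex field: a form that is real on the diagonal is Hermitian.
  For the real part one evaluation at \<open>x + \<i> *\<^sub>C y\<close> suffices, since the factor
  \<open>\<i>\<close> turns imaginary parts into real parts.\<close>

lemma positive_op_symmetric:
  assumes "bounded_clinear A" "positive_op A"
  shows "rinner (A x) y = rinner x (A y)"
proof -
  interpret A: Vector_Spaces.linear scaleC scaleC A
    using assms by (simp add: bounded_clinear_def)
  define z where "z = \<i> *\<^sub>C y"
  have im: "Im (cinner (A u) u) = 0" for u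
    using assms by (auto simp: positive_op_def complex_nonneg_Reals_iff)
  have "Im (cinner (A (x + z)) (x + z)) = 0" by (rule im)
  then have "Im (cinner (A x) z) + Im (cinner (A z) x) = 0"
    by (simp add: A.add cinner_add_left cinner_add_right im)
  moreover have "cinner (A z) x = \<i> * cinner (A y) x"
    by (simp add: z_def A.scale cinner_scaleC_left)
  moreover have "cinner (A x) z = - \<i> * cinner (A x) y"
    by (simp add: z_def cinner_scaleC_right)
  ultimately have "rinner (A x) y = rinner (A y) x"
    by (simp add: rinner_def)
  then show ?thesis
    by (simp add: rinner_commute)
qed

text \<open>Bolzano-Weierstrass in a finite-dimensional complex subspace, with the limit kept in the
  subspace. A new generator \<open>b\<close> outside the span has positive distance from it, so its
  coefficients stay bounded; subsequences are extracted first for the coefficients, then for the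
  remainders.\<close>

lemma finite_rank_convergent_subseq:
  fixes y :: "nat \<Rightarrow> 'a::complex_inner"
  assumes "finite B" "\<And>n. y n \<in> complex_vector.span B" "\<And>n. norm (y n) \<le> c"
  shows "\<exists>r l. strict_mono r \<and> l \<in> complex_vector.span B \<and> (y \<circ> r) \<longlonglongrightarrow> l"
  using assms
proof (induction B arbitrary: y c rule: finite_induct)
  case empty
  then show ?case
    by (intro exI[of _ id] exI[of _ 0]) (auto simp: strict_mono_def o_def)
next
  case (insert b B)
  let ?V = "complex_vector.span B"
  show ?case
  proof (cases "b \<in> ?V")
    case True
    then show ?thesis
      using insert by (metis complex_vector.span_redundant)
  next
    case False
    \<comment> \<open>The induction hypothesis also shows that the span is closed: vectors of
      \<open>?V\<close> approaching \<open>b\<close> would force \<open>b\<close> into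
      \<open>?V\<close>.\<close>
    have "\<exists>d>0. \<forall>v\<in>?V. d \<le> norm (b - v)"
    proof (rule ccontr)
      assume "\<not> ?thesis"
      then have "\<forall>n. \<exists>v\<in>?V. norm (b - v) < inverse (Suc n)"
        by (metis inverse_positive_iff_positive not_le of_nat_0_less_iff zero_less_Suc)
      then obtain v where v: "\<And>n. v n \<in> ?V" "\<And>n. norm (b - v n) < inverse (Suc n)"
        by metis
      have "norm (v n) \<le> norm b + 1" for n
      proof -
        have "inverse (real (Suc n)) \<le> 1" by (simp add: field_simps)
        then show ?thesis
          using v(2)[of n] norm_triangle_ineq2[of "v n" b] by (simp add: norm_minus_commute)
      qed
      then obtain r l where r: "strict_mono (r::nat\<Rightarrow>nat)" "l \<in> ?V" "(v \<circ> r) \<longlonglongrightarrow> l"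
        using insert.IH[of v "norm b + 1"] v by blast
      have "(\<lambda>n. b - v n) \<longlonglongrightarrow> 0"
        by (rule Lim_null_comparison[OF _ LIMSEQ_inverse_real_of_nat])
          (use v in \<open>auto simp del: of_nat_Suc intro!: always_eventually less_imp_le\<close>)
      then have "(\<lambda>n. b - (b - v n)) \<longlonglongrightarrow> b - 0"
        by (intro tendsto_intros)
      then have "(v \<circ> r) \<longlonglongrightarrow> b"
        using LIMSEQ_subseq_LIMSEQ[of v b r] r by simp
      with r False show False
        using LIMSEQ_unique by blast
    qed
    then obtain d where d: "d > 0" "\<And>v. v \<in> ?V \<Longrightarrow> d \<le> norm (b - v)" by blast
    have "\<forall>n. \<exists>k. y n - k *\<^sub>C b \<in> ?V"
      using insert.prems(1) by (auto simp: complex_vector.span_insert)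
    then obtain k where k: "\<And>n. y n - k n *\<^sub>C b \<in> ?V" by metis
    \<comment> \<open>Dividing \<open>y n\<close> by \<open>k n\<close> gives \<open>b\<close> minus
      a vector of \<open>?V\<close>, whose norm is at least \<open>d\<close>.\<close>
    have kb: "d * cmod (k n) \<le> norm (y n)" for n
    proof (cases "k n = 0")
      case False
      define w where "w = y n - k n *\<^sub>C b"
      have "b - (- inverse (k n)) *\<^sub>C w = inverse (k n) *\<^sub>C y n"
        using False
        by (simp add: w_def complex_vector.scale_right_diff_distrib scaleC_scaleC scaleC_one)
      moreover have "(- inverse (k n)) *\<^sub>C w \<in> ?V"
        using k by (auto simp: w_def intro!: complex_vector.span_scale complex_vector.span_neg)
      ultimately have "d \<le> norm (inverse (k n) *\<^sub>C y n)"
        using d by metis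
      then show ?thesis
        using False unfolding norm_scaleC norm_inverse by (simp add: field_simps)
    qed simp
    have kc: "cmod (k n) \<le> c / d" for n
      using kb[of n] insert.prems(2)[of n] d by (simp add: field_simps)
    then have "\<forall>n. k n \<in> cball 0 (c / d)" by auto
    then obtain r1 l1 where r1: "strict_mono (r1::nat\<Rightarrow>nat)" "(k \<circ> r1) \<longlonglongrightarrow> l1"
      using compact_cball[of "0::complex" "c / d"] unfolding compact_def by metis
    have "norm (y (r1 n) - k (r1 n) *\<^sub>C b) \<le> c + c / d * norm b" for n
    proof -
      have "norm (k (r1 n) *\<^sub>C b) \<le> c / d * norm b"
        unfolding norm_scaleC by (intro mult_right_mono kc) simp
      then show ?thesis
        using norm_triangle_ineq4[of "y (r1 n)" "k (r1 n) *\<^sub>C b"] insert.prems(2)[of "r1 n"] by simp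
    qed
    then obtain r2 l2 where r2: "strict_mono (r2::nat\<Rightarrow>nat)" "l2 \<in> ?V"
        "((\<lambda>n. y (r1 n) - k (r1 n) *\<^sub>C b) \<circ> r2) \<longlonglongrightarrow> l2"
      using insert.IH[of "\<lambda>n. y (r1 n) - k (r1 n) *\<^sub>C b" "c + c / d * norm b"] k by blast
    have "(\<lambda>n. k (r1 (r2 n))) \<longlonglongrightarrow> l1"
      using LIMSEQ_subseq_LIMSEQ[OF r1(2) r2(1)] by (simp add: o_def)
    then have "(\<lambda>n. cmod (k (r1 (r2 n)) - l1) * norm b) \<longlonglongrightarrow> 0"
      by (metis LIM_zero tendsto_mult_left_zero tendsto_norm_zero)
    then have "(\<lambda>n. norm (k (r1 (r2 n)) *\<^sub>C b - l1 *\<^sub>C b)) \<longlonglongrightarrow> 0"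
      by (simp add: norm_scaleC[symmetric] complex_vector.scale_left_diff_distrib)
    then have "(\<lambda>n. k (r1 (r2 n)) *\<^sub>C b) \<longlonglongrightarrow> l1 *\<^sub>C b"
      by (metis LIM_zero_cancel tendsto_norm_zero_cancel)
    then have "(\<lambda>n. (y (r1 (r2 n)) - k (r1 (r2 n)) *\<^sub>C b) + k (r1 (r2 n)) *\<^sub>C b) \<longlonglongrightarrow> l2 + l1 *\<^sub>C b"
      using r2(3) by (intro tendsto_add) (simp_all add: o_def)
    then have "(y \<circ> (r1 \<circ> r2)) \<longlonglongrightarrow> l2 + l1 *\<^sub>C b"
      by (simp add: o_def)
    moreover have "l2 + l1 *\<^sub>C b \<in> complex_vector.span (insert b B)"
      using r2(2) by (auto simp: complex_vector.span_insert intro!: exI[of _ l1])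
    moreover have "strict_mono (r1 \<circ> r2)"
      using r1 r2 by (simp add: strict_mono_o)
    ultimately show ?thesis by blast
  qed
qed

subsection \<open>Gaps above zero\<close>

text \<open>Induction on the number of functionals: a vector \<open>v\<close> with \<open>s v v > 0\<close> is split off, and on its
  \<open>s\<close>-orthogonal complement one functional fewer is needed.\<close>

lemma form_gap_finite_positive_index:
  fixes s :: "'a::real_normed_vector \<Rightarrow> 'a \<Rightarrow> real" and \<Phi> :: "('a \<Rightarrow> real) set"
  assumes "finite \<Phi>" and "bounded_bilinear s" and s_sym: "\<And>x y. s x y = s y x"
    and "\<forall>\<phi>\<in>\<Phi>. linear \<phi>" and "subspace W"
    and "\<forall>x\<in>W. (\<forall>\<phi>\<in>\<Phi>. \<phi> x = 0) \<longrightarrow> s x x \<le> 0"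
  shows "\<exists>C\<ge>0. \<forall>x\<in>W. \<forall>b\<ge>0. (\<forall>y\<in>W. s x y \<le> b * norm y) \<longrightarrow> s x x \<le> C * b\<^sup>2"
  using assms(1,4-)
proof (induction \<Phi> arbitrary: W rule: finite_induct)
  case empty
  then show ?case by (intro exI[of _ 0]) auto
next
  case (insert \<phi> \<Phi>)
  interpret s: bounded_bilinear s by fact
  note s_algebra = s.add_left s.add_right s.diff_left s.diff_right s.scaleR_left s.scaleR_right
  show ?case
  proof (cases "\<forall>x\<in>W. (\<forall>\<psi>\<in>\<Phi>. \<psi> x = 0) \<longrightarrow> s x x \<le> 0")
    case True
    then show ?thesis
      using insert by blast
  next
    case False
    then obtain v where v: "v \<in> W" "\<And>\<psi>. \<psi> \<in> \<Phi> \<Longrightarrow> \<psi> v = 0" "s v v > 0"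
      by force
    define W' where "W' = {w \<in> W. s w v = 0}"
    have W': "subspace W'"
      using insert.prems(2) unfolding W'_def subspace_def
      by (auto simp: s_algebra s.zero_left)
    have "s w w \<le> 0" if w: "w \<in> W'" "\<And>\<psi>. \<psi> \<in> \<Phi> \<Longrightarrow> \<psi> w = 0" for w
    proof (rule ccontr)
      assume "\<not> s w w \<le> 0"
      then have pos: "s w w > 0" by simp
      have lin: "linear \<psi>" if "\<psi> \<in> insert \<phi> \<Phi>" for \<psi>
        using insert.prems(1) that by blast
      \<comment> \<open>The combination of \<open>v\<close> and \<open>w\<close> on which \<phi>
        vanishes too. As \<open>v\<close> and \<open>w\<close> are \<open>s\<close>-orthogonal,
        \<open>s u u\<close> is a sum of nonnegative terms, all of which must vanish. Hence
        \<open>\<phi> v = 0\<close>, which contradicts \<open>s v v > 0\<close>.\<close>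
      define u where "u = \<phi> w *\<^sub>R v - \<phi> v *\<^sub>R w"
      have "u \<in> W"
        using insert.prems(2) v w by (auto simp: u_def W'_def subspace_diff subspace_scale)
      moreover have "\<psi> u = 0" if "\<psi> \<in> insert \<phi> \<Phi>" for \<psi>
        using that lin[OF that] v(2) w(2)
        by (fastforce simp: u_def linear_diff linear_scale)
      ultimately have "s u u \<le> 0"
        using insert.prems(3) by blast
      moreover have "s w v = 0" "s v w = 0"
        using w s_sym[of v w] by (auto simp: W'_def)
      then have "s u u = (\<phi> w)\<^sup>2 * s v v + (\<phi> v)\<^sup>2 * s w w"
        by (simp add: u_def s_algebra power2_eq_square)
      moreover have "0 \<le> (\<phi> w)\<^sup>2 * s v v" "0 \<le> (\<phi> v)\<^sup>2 * s w w"
        using v pos by simp_all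
      ultimately have "(\<phi> v)\<^sup>2 * s w w = 0" "(\<phi> w)\<^sup>2 * s v v = 0" by linarith+
      then have "\<phi> v = 0"
        using pos by simp
      then have "s v v \<le> 0"
        using insert.prems(3) v by auto
      with v show False by simp
    qed
    then have "\<exists>C\<ge>0. \<forall>x\<in>W'. \<forall>b\<ge>0. (\<forall>y\<in>W'. s x y \<le> b * norm y) \<longrightarrow> s x x \<le> C * b\<^sup>2"
      using insert.prems(1) W' by (intro insert.IH) auto
    then obtain C where "C \<ge> 0" and C:
      "\<And>x b. x \<in> W' \<Longrightarrow> b \<ge> 0 \<Longrightarrow> (\<And>y. y \<in> W' \<Longrightarrow> s x y \<le> b * norm y) \<Longrightarrow> s x x \<le> C * b\<^sup>2"
      by blast
    have "s x x \<le> (C + (norm v)\<^sup>2 / s v v) * b\<^sup>2"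
      if x: "x \<in> W" "b \<ge> 0" "\<forall>y\<in>W. s x y \<le> b * norm y" for x b
    proof -
      \<comment> \<open>This makes \<open>w\<close> the \<open>s\<close>-orthogonal projection of
        \<open>x\<close> to \<open>W'\<close>. The functionals \<open>s w\<close> and
        \<open>s x\<close> agree on \<open>W'\<close>, so the bound \<open>b\<close> is
        inherited.\<close>
      define a where "a = s x v / s v v"
      define w where "w = x - a *\<^sub>R v"
      have av: "a * s v v = s x v" using v by (simp add: a_def)
      have w: "w \<in> W'"
        using x v insert.prems(2) av by (simp add: w_def W'_def s_algebra subspace_diff subspace_scale)
      have "s w y \<le> b * norm y" if "y \<in> W'" for y
        using x(3) that s_sym[of v y] by (simp add: w_def W'_def s_algebra)
      then have sw: "s w w \<le> C * b\<^sup>2"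
        by (rule C[OF w x(2)])
      have "s x x = s w w + s x v * s x v / s v v"
      proof -
        have "s w v = 0" "s v w = 0" using w s_sym[of v w] by (auto simp: W'_def)
        moreover have "x = w + a *\<^sub>R v" by (simp add: w_def)
        ultimately have "s x x = s w w + a * (a * s v v)"
          by (simp add: s_algebra)
        then show ?thesis unfolding av by (simp add: a_def)
      qed
      moreover have "\<bar>s x v\<bar> \<le> b * norm v"
      proof -
        have "- v \<in> W" using v insert.prems(2) by (simp add: subspace_neg)
        then have "s x (- v) \<le> b * norm v" using x(3) by fastforce
        then show ?thesis using x(3) v by (auto simp: s.minus_right abs_le_iff)
      qed
      then have "(s x v)\<^sup>2 \<le> (b * norm v)\<^sup>2"
        by (metis abs_ge_zero power2_abs power_mono)
      then have "s x v * s x v / s v v \<le> (norm v)\<^sup>2 / s v v * b\<^sup>2"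
        using v by (simp add: power2_eq_square divide_right_mono mult_ac)
      ultimately show ?thesis
        using sw by (simp add: algebra_simps)
    qed
    moreover have "C + (norm v)\<^sup>2 / s v v \<ge> 0"
      using \<open>C \<ge> 0\<close> v by simp
    ultimately show ?thesis by blast
  qed
qed

text \<open>On vectors of \<open>W\<close> orthogonal to the range of \<open>F\<close> the form of
  \<open>F\<close> vanishes, so that of \<open>S\<close> is nonpositive. Finitely many functionals
  cut out these vectors, so the form of \<open>S\<close> has finite positive index on
  \<open>W\<close>.\<close>

lemma symmetric_gap_finite_rank:
  fixes S F :: "'a::complex_inner \<Rightarrow> 'a"
  assumes S: "bounded_linear S" and sym: "\<And>x y. rinner (S x) y = rinner x (S y)"
    and "finite_rank F" and W: "subspace W"
    and le: "\<And>x. x \<in> W \<Longrightarrow> rinner (S x) x \<le> rinner (F x) x"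
  shows "\<exists>C\<ge>0. \<forall>x\<in>W. rinner (S x) x \<le> C * (norm (S x))\<^sup>2"
proof -
  obtain B where B: "finite B" "range F = complex_vector.span B"
    using assms(3) by (auto simp: finite_rank_def finite_dim_def)
  \<comment> \<open>The functionals are real: complex orthogonality to \<open>g\<close> amounts to
    real orthogonality to \<open>g\<close> and \<open>\<i> *\<^sub>C g\<close>.\<close>
  define G where "G = B \<union> scaleC \<i> ` B"
  have nonpos: "rinner (S x) x \<le> 0" if "x \<in> W" and G: "\<And>g. g \<in> G \<Longrightarrow> rinner x g = 0" for x
  proof -
    have 0: "cinner g x = 0" if "g \<in> B" for g
    proof (rule complex_eqI)
      show "Re (cinner g x) = Re 0"
        using G[of g] that rinner_commute[of x g] by (simp add: G_def rinner_def)
      have "rinner (\<i> *\<^sub>C g) x = 0"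
        using G[of "\<i> *\<^sub>C g"] that rinner_commute[of x "\<i> *\<^sub>C g"] by (simp add: G_def)
      then show "Im (cinner g x) = Im 0"
        by (simp add: rinner_def cinner_scaleC_left)
    qed
    have "cinner y x = 0" if "y \<in> complex_vector.span B" for y
      using that
    proof (induction rule: complex_vector.span_induct_alt)
      case (step c g y)
      then show ?case by (simp add: cinner_add_left cinner_scaleC_left 0)
    qed simp
    then have "rinner (F x) x = 0"
      using B by (metis rangeI rinner_def zero_complex.sel(1))
    then show ?thesis using le[OF that(1)] by simp
  qed
  have "\<exists>C\<ge>0. \<forall>x\<in>W. \<forall>b\<ge>0. (\<forall>y\<in>W. rinner (S x) y \<le> b * norm y) \<longrightarrow> rinner (S x) x \<le> C * b\<^sup>2"
  proof (rule form_gap_finite_positive_index)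
    show "finite ((\<lambda>g x. rinner x g) ` G)"
      using B by (simp add: G_def)
    show "bounded_bilinear (\<lambda>x y. rinner (S x) y)"
      using rinner.comp1[OF S] .
    show "rinner (S x) y = rinner (S y) x" for x y
      by (subst sym) (rule rinner_commute)
    show "\<forall>\<phi>\<in>(\<lambda>g x. rinner x g) ` G. linear \<phi>"
      using bounded_linear.linear[OF rinner.bounded_linear_left] by auto
    show "\<forall>x\<in>W. (\<forall>\<phi>\<in>(\<lambda>g x. rinner x g) ` G. \<phi> x = 0) \<longrightarrow> rinner (S x) x \<le> 0"
      using nonpos by simp
  qed (rule W)
  then obtain C where "C \<ge> 0" and
    C: "\<And>x b. x \<in> W \<Longrightarrow> b \<ge> 0 \<Longrightarrow> (\<And>y. y \<in> W \<Longrightarrow> rinner (S x) y \<le> b * norm y) \<Longrightarrow> rinner (S x) x \<le> C * b\<^sup>2"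
    by blast
  \<comment> \<open>By Cauchy-Schwarz the choice \<open>b = norm (S x)\<close> is
    admissible.\<close>
  have "rinner (S x) x \<le> C * (norm (S x))\<^sup>2" if "x \<in> W" for x
    by (rule C[OF that norm_ge_zero rinner_le_norm])
  with \<open>C \<ge> 0\<close> show ?thesis by blast
qed

text \<open>By compactness the distance from \<open>x\<close> to the kernel of \<open>S\<close> is \<open>O(\<parallel>S x\<parallel>)\<close>, and \<open>x\<close> can be moved by a
  kernel vector without changing \<open>\<langle>S x, x\<rangle>\<close>.\<close>

lemma symmetric_gap_compact_perturbation:
  fixes S A B :: "'a::complex_hilbert_space \<Rightarrow> 'a"
  assumes S: "bounded_linear S" and sym: "\<And>x y. rinner (S x) y = rinner x (S y)"
    and W: "subspace W" "closed W"
    and A: "linear A" "\<delta> > 0" "\<And>x. x \<in> W \<Longrightarrow> \<delta> * (norm x)\<^sup>2 \<le> rinner (A x) x"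
    and B: "\<And>y. (\<And>n. norm (y n) \<le> 1) \<Longrightarrow> \<exists>r::nat\<Rightarrow>nat. strict_mono r \<and> convergent (\<lambda>n. B (y (r n)))"
    and SAB: "\<And>x. S x = A x - B x"
  shows "\<exists>C\<ge>0. \<forall>x\<in>W. rinner (S x) x \<le> C * (norm (S x))\<^sup>2"
proof -
  interpret S: bounded_linear S by fact
  define Z where "Z = {z\<in>W. S z = 0}"
  have Z0: "0 \<in> Z" using W by (simp add: Z_def subspace_0 S.zero)
  have subZ: "subspace Z"
    using W unfolding Z_def subspace_def by (auto simp: S.zero S.add S.scaleR)
  have Scont: "(\<lambda>n. S (u n)) \<longlonglongrightarrow> S l" if "u \<longlonglongrightarrow> l" for u l
    using S.tendsto[OF that] .
  \<comment> \<open>Otherwise there are unit vectors \<open>y n\<close> of \<open>W\<close> at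
    distance at least 1/2 from \<open>Z\<close> with \<open>S (y n)\<close> tending to 0; a
    subsequence then converges to a point of \<open>Z\<close>, a contradiction.\<close>
  have "\<exists>n::nat. \<forall>x\<in>W. \<exists>z\<in>Z. norm (x - z) \<le> n * norm (S x)"
  proof (rule ccontr)
    assume "\<not> ?thesis"
    then have neg: "\<exists>x\<in>W. \<forall>z\<in>Z. norm (x - z) > n * norm (S x)" for n :: nat
      by (meson not_le)
    have "\<exists>y\<in>W. norm y = 1 \<and> norm (S y) < inverse (Suc n) \<and> (\<forall>z\<in>Z. 1/2 \<le> norm (y - z))" for n
    proof -
      obtain x where x: "x \<in> W" "\<And>z. z \<in> Z \<Longrightarrow> norm (x - z) > Suc n * norm (S x)"
        using neg by blast
      have "S x \<noteq> 0" using x(2)[of x] x(1) by (auto simp: Z_def)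
      then have Sx: "norm (S x) > 0" by simp
      define d where "d = infdist x Z"
      have "Suc n * norm (S x) \<le> d"
        unfolding d_def infdist_notempty[OF ex_in_conv[THEN iffD1, OF exI, OF Z0]]
        by (rule cINF_greatest) (use Z0 x(2) in \<open>auto simp: dist_norm intro: less_imp_le\<close>)
      moreover have "0 < Suc n * norm (S x)" using Sx by simp
      ultimately have d: "d > 0" by linarith
      \<comment> \<open>A point of \<open>Z\<close> within twice the distance replaces a nearest
        one; after normalising it yields the constant 1/2.\<close>
      then obtain z where z: "z \<in> Z" "norm (x - z) < 2 * d"
        using infdist_notempty[of Z x] Z0 cInf_lessD[of "dist x ` Z" "2 * d"]
        by (force simp: d_def dist_norm)
      define N where "N = norm (x - z)"
      have N: "N > 0" using x(2)[OF z(1)] Sx by (smt (verit) N_def mult_nonneg_nonneg norm_ge_zero of_nat_0_le_iff)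
      define y where "y = (1 / N) *\<^sub>R (x - z)"
      have zW: "z \<in> W" "S z = 0" using z by (auto simp: Z_def)
      have "y \<in> W" using x zW W by (simp add: y_def subspace_diff subspace_scale)
      moreover have "norm y = 1" using N by (simp add: y_def N_def)
      moreover have "norm (S y) < inverse (Suc n)"
      proof -
        have "norm (S y) = norm (S x) / N"
          using N zW by (simp add: y_def S.scaleR S.diff)
        moreover have "norm (S x) / N < inverse (real (Suc n))"
          using x(2)[OF z(1)] N by (simp add: N_def[symmetric] field_simps)
        ultimately show ?thesis by simp
      qed
      moreover have "1/2 \<le> norm (y - z')" if z': "z' \<in> Z" for z'
      proof -
        have "z + N *\<^sub>R z' \<in> Z" using subZ z z' by (simp add: subspace_add subspace_scale)
        then have "d \<le> norm (x - (z + N *\<^sub>R z'))"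
          by (metis d_def dist_norm infdist_le)
        also have "x - (z + N *\<^sub>R z') = N *\<^sub>R (y - z')"
          using N by (simp add: y_def scaleR_diff_right algebra_simps)
        also have "norm \<dots> = N * norm (y - z')" using N by simp
        finally have "N * (1/2) < N * norm (y - z')" using z(2) by (simp add: N_def)
        then show ?thesis using N by simp
      qed
      ultimately show ?thesis by blast
    qed
    then obtain y where y: "\<And>n. y n \<in> W" "\<And>n. norm (y n) = 1"
      "\<And>n. norm (S (y n)) < inverse (Suc n)" "\<And>n z. z \<in> Z \<Longrightarrow> 1/2 \<le> norm (y n - z)"
      by metis
    obtain r :: "nat \<Rightarrow> nat" where r: "strict_mono r" "convergent (\<lambda>n. B (y (r n)))"
      using B[of y] y by auto
    have "(\<lambda>n. S (y n)) \<longlonglongrightarrow> 0"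
      by (rule Lim_null_comparison[OF _ LIMSEQ_inverse_real_of_nat])
        (use y in \<open>auto simp del: of_nat_Suc intro!: always_eventually less_imp_le\<close>)
    then have S0: "(\<lambda>n. S (y (r n))) \<longlonglongrightarrow> 0"
      using LIMSEQ_subseq_LIMSEQ r by (force simp: o_def)
    \<comment> \<open>Along the subsequence \<open>S y\<close> tends to 0 and \<open>B y\<close>
      converges, so \<open>A y\<close> converges; the lower bound \<open>low\<close> carries the
      Cauchy property back to \<open>y\<close>.\<close>
    have "A x = S x + B x" for x by (simp add: SAB)
    then have "convergent (\<lambda>n. A (y (r n)))"
      using convergent_add[OF _ r(2)] S0 by (simp add: convergent_def) metis
    then have CA: "Cauchy (\<lambda>n. A (y (r n)))" by (rule convergent_Cauchy)
    have low: "\<delta> * norm x \<le> norm (A x)" if "x \<in> W" for x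
    proof (cases "x = 0")
      case False
      have "\<delta> * norm x * norm x \<le> norm (A x) * norm x"
        using A(3)[OF that] rinner_le_norm[of "A x" x] by (simp add: power2_eq_square)
      then show ?thesis using False by simp
    qed simp
    have "Cauchy (\<lambda>n. y (r n))"
    proof (rule CauchyI)
      fix e :: real assume "e > 0"
      then have "\<delta> * e > 0" using A by simp
      then obtain N where N: "\<And>m n. m \<ge> N \<Longrightarrow> n \<ge> N \<Longrightarrow> norm (A (y (r m)) - A (y (r n))) < \<delta> * e"
        using CauchyD[OF CA] by meson
      have "norm (y (r m) - y (r n)) < e" if "m \<ge> N" "n \<ge> N" for m n
      proof -
        have "\<delta> * norm (y (r m) - y (r n)) \<le> norm (A (y (r m) - y (r n)))"
          by (rule low) (use y W in \<open>simp add: subspace_diff\<close>)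
        also have "\<dots> < \<delta> * e"
          using N[OF that] A(1) by (simp add: linear_diff)
        finally show ?thesis using A by simp
      qed
      then show "\<exists>N. \<forall>m\<ge>N. \<forall>n\<ge>N. norm (y (r m) - y (r n)) < e" by blast
    qed
    then obtain l where l: "(\<lambda>n. y (r n)) \<longlonglongrightarrow> l"
      using Cauchy_convergent convergent_def by blast
    have "l \<in> W" using closed_sequentially[OF W(2) _ l] y by blast
    moreover have "S l = 0"
      using LIMSEQ_unique[OF Scont[OF l] S0] .
    ultimately have "l \<in> Z" by (simp add: Z_def)
    moreover have "(\<lambda>n. norm (y (r n) - l)) \<longlonglongrightarrow> 0"
      using l by (simp add: LIM_zero tendsto_norm_zero)
    then have "\<forall>\<^sub>F n in sequentially. norm (y (r n) - l) < 1/2"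
      by (rule order_tendstoD) simp
    then obtain n where "norm (y (r n) - l) < 1/2"
      by (auto simp: eventually_sequentially)
    ultimately show False using y(4)[of l "r n"] by simp
  qed
  then obtain n :: nat where n: "\<And>x. x \<in> W \<Longrightarrow> \<exists>z\<in>Z. norm (x - z) \<le> n * norm (S x)"
    by blast
  have "rinner (S x) x \<le> n * (norm (S x))\<^sup>2" if x: "x \<in> W" for x
  proof -
    obtain z where z: "z \<in> Z" "norm (x - z) \<le> n * norm (S x)" using n[OF x] by blast
    \<comment> \<open>The range of a symmetric operator is orthogonal to its kernel.\<close>
    have "rinner (S x) z = 0" using z by (simp add: sym Z_def rinner.zero_right)
    then have "rinner (S x) x = rinner (S x) (x - z)" by (simp add: rinner_algebra)
    also have "\<dots> \<le> norm (S x) * norm (x - z)" by (rule rinner_le_norm)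
    also have "\<dots> \<le> norm (S x) * (n * norm (S x))" using z by (simp add: mult_left_mono)
    finally show ?thesis by (simp add: power2_eq_square mult_ac)
  qed
  then show ?thesis by (meson of_nat_0_le_iff)
qed

subsection \<open>From a gap to an eigenvector\<close>

text \<open>The map \<open>1 - S / L\<close> shrinks \<open>S x\<close> by a fixed factor
  \<open>q < 1\<close>, so the iterates move by geometrically decreasing steps and \<open>S\<close>
  vanishes at their limit. Starting from a unit vector with \<open>norm (S x0) < 1 - q\<close> keeps
  the limit away from 0.\<close>

lemma kernel_vector_if_gap:
  fixes S :: "'a::complex_hilbert_space \<Rightarrow> 'a"
  assumes S: "bounded_linear S" and sym: "\<And>x y. rinner (S x) y = rinner x (S y)"
    and M: "subspace M" "closed M" "S ` M \<subseteq> M"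
    and pos: "\<And>x. x \<in> M \<Longrightarrow> 0 \<le> rinner (S x) x"
    and C: "C \<ge> 0" "\<And>x. x \<in> M \<Longrightarrow> rinner (S x) x \<le> C * (norm (S x))\<^sup>2"
    and approx: "\<And>e. e > 0 \<Longrightarrow> \<exists>x\<in>M. norm x = 1 \<and> rinner (S x) x < e"
  shows "\<exists>x\<in>M. norm x = 1 \<and> S x = 0"
proof -
  interpret S: bounded_linear S by fact
  obtain L0 where L0: "L0 > 0" "\<And>x. norm (S x) \<le> norm x * L0"
    using S.pos_bounded by blast
  define L where "L = L0 + 1"
  define \<epsilon> where "\<epsilon> = 1 / (C + 1)"
  have L: "L > 1" "\<And>x. norm (S x) \<le> L * norm x"
  proof -
    show "L > 1" using L0 by (simp add: L_def)
    show "norm (S x) \<le> L * norm x" for x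
      using L0(2)[of x] norm_ge_zero[of x] unfolding L_def by (simp only: algebra_simps)
  qed
  have \<epsilon>: "\<epsilon> > 0" "\<epsilon> \<le> 1" using C by (simp_all add: \<epsilon>_def)
  have SM: "S x \<in> M" if "x \<in> M" for x using M that by blast
  have gap: "\<epsilon> * rinner (S x) x \<le> (norm (S x))\<^sup>2" if "x \<in> M" for x
  proof -
    have "rinner (S x) x \<le> (C + 1) * (norm (S x))\<^sup>2"
      using C(2)[OF that] zero_le_power2[of "norm (S x)"]
      by (simp only: distrib_right mult_1)
    then show ?thesis using C(1) by (simp add: \<epsilon>_def field_simps)
  qed
  \<comment> \<open>\<open>S\<^sup>2 \<le> L S\<close> on \<open>M\<close>, from positivity of the
    form at \<open>L *\<^sub>R x - S x\<close> together with \<open>S \<le> L\<close>.\<close>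
  have upper: "(norm (S x))\<^sup>2 \<le> L * rinner (S x) x" if "x \<in> M" for x
  proof -
    define y where "y = S x"
    have y: "y \<in> M" using SM that by (simp add: y_def)
    have "rinner (S y) y \<le> norm (S y) * norm y" by (rule rinner_le_norm)
    also have "\<dots> \<le> L * norm y * norm y" using L(2)[of y] by (intro mult_right_mono) simp_all
    finally have 1: "rinner (S y) y \<le> L * (norm y)\<^sup>2" by (simp add: power2_eq_square mult_ac)
    have "L *\<^sub>R x - y \<in> M" using M that y by (simp add: subspace_diff subspace_scale)
    from pos[OF this] have "0 \<le> L * (L * rinner (S x) x) - L * rinner (S x) y - L * rinner (S y) x + rinner (S y) y"
      by (simp add: S.diff S.scaleR rinner_algebra algebra_simps)
    moreover have "rinner (S x) y = (norm y)\<^sup>2" "rinner (S y) x = (norm y)\<^sup>2"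
      using sym[of y x] by (simp_all add: y_def rinner_self)
    ultimately have "0 \<le> L * (L * rinner (S x) x - (norm y)\<^sup>2)"
      using 1 by (simp add: algebra_simps)
    then show ?thesis using L(1) by (simp add: y_def zero_le_mult_iff)
  qed
  \<comment> \<open>\<open>S\<^sup>2 (S - \<epsilon>) = S (S - \<epsilon>)\<^sup>2 + \<epsilon> (S\<^sup>2 - \<epsilon> S)\<close> is a sum of positive terms, so \<open>S \<ge> \<epsilon>\<close> on the range\<close>
  have range_gap: "\<epsilon> * (norm (S x))\<^sup>2 \<le> rinner (S (S x)) (S x)" if "x \<in> M" for x
  proof -
    define y where "y = S x"
    have y: "y \<in> M" using SM that by (simp add: y_def)
    have "y - \<epsilon> *\<^sub>R x \<in> M" using M that y by (simp add: subspace_diff subspace_scale)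
    from pos[OF this] have "0 \<le> rinner (S y) y - \<epsilon> * rinner (S y) x - \<epsilon> * rinner (S x) y + \<epsilon> * (\<epsilon> * rinner (S x) x)"
      by (simp add: S.diff S.scaleR rinner_algebra algebra_simps)
    moreover have "rinner (S x) y = (norm y)\<^sup>2" "rinner (S y) x = (norm y)\<^sup>2"
      using sym[of y x] by (simp_all add: y_def rinner_self)
    moreover have "\<epsilon> * (\<epsilon> * rinner (S x) x) \<le> \<epsilon> * (norm y)\<^sup>2"
      using gap[OF that] \<epsilon> by (simp add: y_def)
    ultimately show ?thesis by (simp add: y_def)
  qed
  define q where "q = sqrt (1 - \<epsilon> / L)"
  have "\<epsilon> / L < 1" using L \<epsilon> by (simp add: field_simps)
  then have q: "0 < q" "q < 1" using L \<epsilon> by (simp_all add: q_def)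
  have q2: "q\<^sup>2 = 1 - \<epsilon> / L"
    using \<open>\<epsilon> / L < 1\<close> by (simp add: q_def)
  define g where "g x = x - (1 / L) *\<^sub>R S x" for x
  have gM: "g x \<in> M" if "x \<in> M" for x
    using M SM that by (simp add: g_def subspace_diff subspace_scale)
  have contr: "norm (S (g x)) \<le> q * norm (S x)" if "x \<in> M" for x
  proof -
    define y where "y = S x"
    have y: "y \<in> M" using SM that by (simp add: y_def)
    have "S (g x) = y - (1 / L) *\<^sub>R S y"
      by (simp add: g_def y_def S.diff S.scaleR)
    then have "(norm (S (g x)))\<^sup>2 = rinner (y - (1 / L) *\<^sub>R S y) (y - (1 / L) *\<^sub>R S y)"
      by (simp add: rinner_self)
    also have "\<dots> = (norm y)\<^sup>2 - 2 / L * rinner (S y) y + (norm (S y))\<^sup>2 / L\<^sup>2"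
      using rinner_commute[of y "S y"]
      unfolding rinner_self[symmetric]
      by (simp add: rinner.diff_left rinner.diff_right rinner.scaleR_left rinner.scaleR_right
          power2_eq_square diff_divide_distrib)
    \<comment> \<open>The bound \<open>upper\<close> at \<open>y\<close> absorbs the quadratic term
      into half of the linear one; \<open>range_gap\<close> bounds the other half and produces
      \<open>q\<^sup>2\<close>.\<close>
    also have "\<dots> \<le> (norm y)\<^sup>2 - 2 / L * rinner (S y) y + L * rinner (S y) y / L\<^sup>2"
      using upper[OF y] by (simp add: divide_right_mono)
    also have "\<dots> = (norm y)\<^sup>2 - rinner (S y) y / L"
      using L(1) by (simp add: power2_eq_square field_simps)
    also have "\<dots> \<le> (norm y)\<^sup>2 - \<epsilon> * (norm y)\<^sup>2 / L"
      using range_gap[OF that] L(1) by (simp add: y_def divide_right_mono)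
    also have "\<dots> = (q * norm y)\<^sup>2"
      unfolding power_mult_distrib q2 by (simp add: algebra_simps)
    finally have "norm (S (g x)) \<le> q * norm y"
      by (rule power2_le_imp_le) (use q in simp)
    then show ?thesis by (simp add: y_def)
  qed
  \<comment> \<open>The threshold is chosen so that \<open>upper\<close> gives
    \<open>\<eta> < 1 - q\<close>.\<close>
  obtain x0 where x0: "x0 \<in> M" "norm x0 = 1" "rinner (S x0) x0 < (1 - q)\<^sup>2 / L"
    using approx[of "(1 - q)\<^sup>2 / L"] q L by auto
  define \<eta> where "\<eta> = norm (S x0)"
  have "\<eta>\<^sup>2 < (1 - q)\<^sup>2"
    using upper[OF x0(1)] x0(3) L(1) by (simp add: \<eta>_def field_simps)
  then have \<eta>: "\<eta> < 1 - q"
    by (rule power2_less_imp_less) (use q in simp)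
  define X where "X n = (g ^^ n) x0" for n
  have XM: "X n \<in> M" for n
    by (induction n) (simp_all add: X_def x0 gM)
  have SX: "norm (S (X n)) \<le> \<eta> * q ^ n" for n
  proof (induction n)
    case (Suc n)
    have "norm (S (X (Suc n))) \<le> q * norm (S (X n))"
      using contr[OF XM] by (simp add: X_def)
    also have "\<dots> \<le> q * (\<eta> * q ^ n)" using Suc q by simp
    finally show ?case by (simp add: mult_ac)
  qed (simp add: X_def \<eta>_def)
  define d where "d n = X (Suc n) - X n" for n
  have nd: "norm (d n) \<le> \<eta> * q ^ n" for n
  proof -
    have "norm (d n) = norm (S (X n)) / L"
      using L(1) by (simp add: d_def X_def g_def)
    also have "\<dots> \<le> norm (S (X n)) / 1" using L(1) by (intro divide_left_mono) simp_all
    finally show ?thesis using SX[of n] by simp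
  qed
  have geo: "(\<lambda>n. \<eta> * q ^ n) sums (\<eta> * (1 / (1 - q)))"
    using q by (intro sums_mult geometric_sums) simp
  then have "summable d"
    using nd by (intro summable_comparison_test'[of "\<lambda>n. \<eta> * q ^ n" 0 d]) (auto simp: sums_iff)
  then have "(\<lambda>n. \<Sum>k<n. d k) \<longlonglongrightarrow> suminf d" by (rule summable_LIMSEQ)
  then have "(\<lambda>n. x0 + (\<Sum>k<n. d k)) \<longlonglongrightarrow> x0 + suminf d" by (intro tendsto_intros)
  moreover have "x0 + (\<Sum>k<n. d k) = X n" for n
    unfolding d_def sum_lessThan_telescope by (simp add: X_def)
  ultimately have lim: "X \<longlonglongrightarrow> x0 + suminf d" by simp
  define l where "l = x0 + suminf d"
  have "l \<in> M" using closed_sequentially[OF M(2) XM lim] by (simp add: l_def)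
  have "(\<lambda>n. S (X n)) \<longlonglongrightarrow> 0"
  proof (rule Lim_null_comparison)
    show "(\<lambda>n. \<eta> * q ^ n) \<longlonglongrightarrow> 0" using geo by (auto intro: summable_LIMSEQ_zero simp: sums_iff)
  qed (use SX in simp)
  moreover have "(\<lambda>n. S (X n)) \<longlonglongrightarrow> S l" using S.tendsto[OF lim] by (simp add: l_def)
  ultimately have "S l = 0" using LIMSEQ_unique by blast
  \<comment> \<open>The total displacement is less than \<open>norm x0 = 1\<close>, so the limit
    cannot be 0.\<close>
  have "norm (suminf d) \<le> \<eta> * (1 / (1 - q))"
    using norm_suminf_le[of d "\<lambda>n. \<eta> * q ^ n"] nd geo by (simp add: sums_iff)
  also have "\<dots> < 1" using \<eta> q by (simp add: field_simps)
  finally have "l \<noteq> 0"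
    using x0(2) by (auto simp: l_def add_eq_0_iff)
  then show ?thesis
    using \<open>l \<in> M\<close> \<open>S l = 0\<close> M(1)
    by (intro bexI[of _ "(1 / norm l) *\<^sub>R l"]) (auto simp: S.scaleR subspace_scale)
qed

text \<open>With \<mu> the infimum of the form over the unit vectors of \<open>M\<close>, a unit
  kernel vector of \<open>T - \<mu>\<close> has image of norm \<mu>. This is the minimum modulus
  because \<open>norm (T u) \<ge> rinner (T u) u \<ge> \<mu>\<close> for every unit vector
  \<open>u\<close> of \<open>M\<close>.\<close>

lemma minimum_attaining_if_gap:
  fixes T :: "'a::complex_hilbert_space \<Rightarrow> 'a"
  assumes T: "bounded_clinear T" "positive_op T"
    and gap: "\<And>\<mu>. \<exists>C\<ge>0. \<forall>x. rinner (T x - \<mu> *\<^sub>R x) x \<le> C * (norm (T x - \<mu> *\<^sub>R x))\<^sup>2"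
    and M: "subspace M" "closed M" "M \<noteq> {0}" "T ` M \<subseteq> M"
  shows "minimum_attaining T M"
proof -
  interpret T: bounded_linear T by (rule bounded_clinear_imp_bounded_linear[OF T(1)])
  define U where "U = {x\<in>M. norm x = 1}"
  define \<mu> where "\<mu> = (INF x\<in>U. rinner (T x) x)"
  obtain v where "v \<in> M" "v \<noteq> 0" using M subspace_0 by blast
  then have "(1 / norm v) *\<^sub>R v \<in> U" using M by (simp add: U_def subspace_scale)
  then have U: "U \<noteq> {}" by blast
  have bdd: "bdd_below ((\<lambda>x. rinner (T x) x) ` U)"
    using positive_op_nonneg[OF T(2)] by (intro bdd_belowI[of _ 0]) auto
  have \<mu>0: "\<mu> \<ge> 0"
    unfolding \<mu>_def using U positive_op_nonneg[OF T(2)] by (intro cINF_greatest) auto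
  have \<mu>_le: "\<mu> \<le> rinner (T x) x" if "x \<in> U" for x
    unfolding \<mu>_def using bdd that by (rule cINF_lower)
  define S where "S x = T x - \<mu> *\<^sub>R x" for x
  have S: "bounded_linear S"
    unfolding S_def by (intro bounded_linear_sub T.bounded_linear_axioms bounded_linear_scaleR_right)
  obtain C where C: "C \<ge> 0" "\<And>x. rinner (S x) x \<le> C * (norm (S x))\<^sup>2"
    using gap[of \<mu>] by (auto simp: S_def)
  have "\<exists>x\<in>M. norm x = 1 \<and> S x = 0"
  proof (rule kernel_vector_if_gap[OF S _ M(1,2)])
    show "rinner (S x) y = rinner x (S y)" for x y
      using positive_op_symmetric[OF T] by (simp add: S_def rinner_algebra)
    show "S ` M \<subseteq> M"
      using M by (auto simp: S_def intro!: subspace_diff subspace_scale)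
    show "0 \<le> C" by fact
    show "rinner (S x) x \<le> C * (norm (S x))\<^sup>2" for x by fact
    show "0 \<le> rinner (S x) x" if "x \<in> M" for x
    proof (cases "x = 0")
      case False
      define u where "u = (1 / norm x) *\<^sub>R x"
      have "u \<in> U" using that False M by (simp add: U_def u_def subspace_scale)
      then have "0 \<le> (norm x)\<^sup>2 * (rinner (T u) u - \<mu>)" using \<mu>_le by simp
      also have "\<dots> = rinner (T x) x - \<mu> * (norm x)\<^sup>2"
        using False by (simp add: u_def T.scaleR rinner_algebra power2_eq_square field_simps)
      also have "\<dots> = rinner (S x) x" by (simp add: S_def rinner_algebra)
      finally show ?thesis .
    qed (simp add: rinner.zero_right)
    show "\<exists>x\<in>M. norm x = 1 \<and> rinner (S x) x < e" if e: "e > 0" for e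
    proof -
      obtain x where "x \<in> U" "rinner (T x) x < \<mu> + e"
        using cInf_lessD[of "(\<lambda>x. rinner (T x) x) ` U" "\<mu> + e"] U e by (auto simp: \<mu>_def)
      then show ?thesis by (auto simp: S_def U_def rinner_algebra)
    qed
  qed
  then obtain x where x: "x \<in> U" "T x = \<mu> *\<^sub>R x"
    by (auto simp: S_def U_def)
  have "min_modulus T M = norm (T x)"
    unfolding min_modulus_def U_def[symmetric]
  proof (rule cInf_eq_minimum)
    show "norm (T x) \<le> b" if b: "b \<in> (\<lambda>x. norm (T x)) ` U" for b
    proof -
      obtain u where u: "u \<in> U" "b = norm (T u)" using b by blast
      have "norm (T x) = \<mu>" using x \<mu>0 by (simp add: U_def)
      also have "\<dots> \<le> rinner (T u) u" using u \<mu>_le by blast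
      also have "\<dots> \<le> b" using u rinner_le_norm[of "T u" u] by (simp add: U_def)
      finally show ?thesis .
    qed
  qed (use x in blast)
  then show ?thesis
    using x by (auto simp: minimum_attaining_def U_def)
qed

subsection \<open>Orthogonal resolutions of the identity\<close>

locale orthogonal_resolution =
  fixes \<Lambda> :: "real set" and P :: "real \<Rightarrow> 'a::complex_hilbert_space \<Rightarrow> 'a"
  assumes proj: "\<And>l. l \<in> \<Lambda> \<Longrightarrow> orth_projection (P l)"
    and orth: "\<And>l m x. l \<in> \<Lambda> \<Longrightarrow> m \<in> \<Lambda> \<Longrightarrow> l \<noteq> m \<Longrightarrow> P l (P m x) = 0"
    and sums_id: "has_sot_sum P \<Lambda> (\<lambda>x. x)"
begin

lemma bounded_linear_P: "l \<in> \<Lambda> \<Longrightarrow> bounded_linear (P l)"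
  using proj by (simp add: orth_projection_def bounded_clinear_imp_bounded_linear)

lemma P_idem: "l \<in> \<Lambda> \<Longrightarrow> P l (P l x) = P l x"
  using proj by (simp add: orth_projection_def)

lemma rinner_P: "l \<in> \<Lambda> \<Longrightarrow> rinner (P l x) y = rinner (P l x) (P l y)"
  using proj[of l] by (metis orth_projection_def self_adjoint_def is_adjoint_def rinner_def)

lemma has_sum_P: "((\<lambda>l. P l x) has_sum x) \<Lambda>"
  using sums_id by (simp add: has_sot_sum_def)

text \<open>Parseval's identity; the second projection can be inserted because \<open>P l\<close> is
  self-adjoint and idempotent.\<close>

lemma has_sum_rinner_P: "((\<lambda>l. rinner (P l x) (P l y)) has_sum rinner x y) \<Lambda>"
proof -
  have "((\<lambda>l. rinner (P l x) y) has_sum rinner x y) \<Lambda>"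
    by (rule has_sum_bounded_linear[OF rinner.bounded_linear_left has_sum_P])
  then show ?thesis
    by (rule has_sum_cong[THEN iffD1, rotated]) (rule rinner_P)
qed

lemma has_sum_norm_P: "((\<lambda>l. (norm (P l x))\<^sup>2) has_sum (norm x)\<^sup>2) \<Lambda>"
  using has_sum_rinner_P[of x x] by (simp add: rinner_self)

text \<open>Continuity moves \<open>P m\<close> inside the sum, where orthogonality leaves at most
  the term with index \<open>m\<close>. The parameters \<open>\<Lambda>'\<close> and
  \<open>f\<close> serve both the splitting of a vector and the diagonal operator.\<close>

lemma P_has_sum:
  assumes "((\<lambda>l. f l *\<^sub>R P l x) has_sum s) \<Lambda>'" "\<Lambda>' \<subseteq> \<Lambda>" "m \<in> \<Lambda>"
  shows "P m s = (if m \<in> \<Lambda>' then f m else 0) *\<^sub>R P m x"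
proof -
  interpret P: bounded_linear "P m" using assms by (simp add: bounded_linear_P)
  have "((\<lambda>l. P m (f l *\<^sub>R P l x)) has_sum P m s) \<Lambda>'"
    by (rule has_sum_bounded_linear[OF P.bounded_linear_axioms assms(1)])
  moreover have "((\<lambda>l. P m (f l *\<^sub>R P l x)) has_sum (\<Sum>l\<in>\<Lambda>' \<inter> {m}. f l *\<^sub>R P l x)) \<Lambda>'"
  proof (rule has_sum_cong_neutral[THEN iffD1, OF _ _ _ has_sum_finite])
    show "f l *\<^sub>R P l x = P m (f l *\<^sub>R P l x)" if "l \<in> (\<Lambda>' \<inter> {m}) \<inter> \<Lambda>'" for l
      using that assms by (auto simp: P.scaleR P_idem)
    show "P m (f l *\<^sub>R P l x) = 0" if "l \<in> \<Lambda>' - \<Lambda>' \<inter> {m}" for l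
      using that assms orth[of m l x] by (auto simp: P.scaleR)
  qed auto
  ultimately have "P m s = (\<Sum>l\<in>\<Lambda>' \<inter> {m}. f l *\<^sub>R P l x)"
    by (rule has_sum_unique)
  then show ?thesis by (cases "m \<in> \<Lambda>'") simp_all
qed

text \<open>The component \<open>u\<close> is the sum of \<open>P l x\<close> over
  \<open>\<Lambda>'\<close>, convergent by completeness, and \<open>v\<close> is the rest.\<close>

lemma split:
  assumes "\<Lambda>' \<subseteq> \<Lambda>"
  obtains u v where "x = u + v" "\<And>l. l \<in> \<Lambda> - \<Lambda>' \<Longrightarrow> P l u = 0" "\<And>l. l \<in> \<Lambda>' \<Longrightarrow> P l v = 0"
proof -
  have "(\<lambda>l. P l x) summable_on \<Lambda>'"
    using has_sum_P assms summable_on_subset_banach summable_on_def by blast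
  then obtain u where "((\<lambda>l. P l x) has_sum u) \<Lambda>'"
    by (auto simp: summable_on_def)
  then have u: "P m u = (if m \<in> \<Lambda>' then P m x else 0)" if "m \<in> \<Lambda>" for m
    using P_has_sum[of "\<lambda>_. 1" x \<Lambda>' u m] assms that by auto
  have "P l (x - u) = 0" if "l \<in> \<Lambda>'" for l
    using that assms u[of l] bounded_linear.linear[OF bounded_linear_P[of l]]
    by (auto simp: linear_diff)
  then show thesis
    using u by (intro that[of u "x - u"]) auto
qed

lemma rinner_eq_0:
  assumes "\<And>l. l \<in> \<Lambda> \<Longrightarrow> P l x = 0 \<or> P l y = 0"
  shows "rinner x y = 0"
proof -
  have "((\<lambda>l. rinner (P l x) (P l y)) has_sum 0) \<Lambda>"
    using assms by (intro has_sum_0) (metis rinner.zero_left rinner.zero_right)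
  then show ?thesis
    using has_sum_rinner_P has_sum_unique by blast
qed

lemma closed_subspace_P_eq_0:
  assumes "\<Lambda>' \<subseteq> \<Lambda>"
  shows "subspace {x. \<forall>l\<in>\<Lambda>'. P l x = 0}" "closed {x. \<forall>l\<in>\<Lambda>'. P l x = 0}"
proof -
  have bl: "bounded_linear (P l)" if "l \<in> \<Lambda>'" for l
    using that assms bounded_linear_P by blast
  then show "subspace {x. \<forall>l\<in>\<Lambda>'. P l x = 0}"
    by (simp add: subspace_def bounded_linear.linear linear_add linear_scale linear_0)
  have "{x. \<forall>l\<in>\<Lambda>'. P l x = 0} = (\<Inter>l\<in>\<Lambda>'. {x. P l x = 0})" by blast
  moreover have "closed {x. P l x = 0}" if "l \<in> \<Lambda>'" for l
    using bl[OF that] by (intro closed_Collect_eq linear_continuous_on continuous_on_const)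
  ultimately show "closed {x. \<forall>l\<in>\<Lambda>'. P l x = 0}"
    by (simp add: closed_INT)
qed

end

section \<open>Diagonal operators and their perturbations\<close>

locale diagonal_operator = orthogonal_resolution +
  fixes D
  assumes bdd: "bounded \<Lambda>"
    and has_sum_D: "\<And>x. ((\<lambda>l. l *\<^sub>R P l x) has_sum D x) \<Lambda>"
begin

lemma P_D: "l \<in> \<Lambda> \<Longrightarrow> P l (D x) = l *\<^sub>R P l x"
  using P_has_sum[OF has_sum_D] by simp

lemma has_sum_rinner_D: "((\<lambda>l. l * (norm (P l x))\<^sup>2) has_sum rinner (D x) x) \<Lambda>"
  using has_sum_rinner_P[of "D x" x]
  by (rule has_sum_cong[THEN iffD1, rotated]) (simp add: P_D rinner_algebra)

lemma D_upper:
  assumes "\<And>l. l \<in> \<Lambda> \<Longrightarrow> c < l \<Longrightarrow> P l x = 0"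
  shows "rinner (D x) x \<le> c * (norm x)\<^sup>2"
proof (rule has_sum_mono[OF has_sum_rinner_D has_sum_cmult_right[OF has_sum_norm_P]])
  show "l * (norm (P l x))\<^sup>2 \<le> c * (norm (P l x))\<^sup>2" if "l \<in> \<Lambda>" for l
    using assms[OF that] by (cases "c < l") (auto intro: mult_right_mono)
qed

lemma D_lower:
  assumes "\<And>l. l \<in> \<Lambda> \<Longrightarrow> l < c \<Longrightarrow> P l x = 0"
  shows "c * (norm x)\<^sup>2 \<le> rinner (D x) x"
proof (rule has_sum_mono[OF has_sum_cmult_right[OF has_sum_norm_P] has_sum_rinner_D])
  show "c * (norm (P l x))\<^sup>2 \<le> l * (norm (P l x))\<^sup>2" if "l \<in> \<Lambda>" for l
    using assms[OF that] by (cases "l < c") (auto intro: mult_right_mono)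
qed

text \<open>Linearity follows from uniqueness of sums; Parseval's identity turns the bound on the
  coefficients into a bound on the operator.\<close>

lemma bounded_clinear_D: "bounded_clinear D"
  unfolding bounded_clinear_def
proof (intro conjI)
  have Pc: "P l (c *\<^sub>C x) = c *\<^sub>C P l x" if "l \<in> \<Lambda>" for l c x
  proof -
    interpret Vector_Spaces.linear scaleC scaleC "P l"
      using proj[OF that] by (simp add: orth_projection_def bounded_clinear_def)
    show ?thesis by (rule scale)
  qed
  have add: "D (x + y) = D x + D y" for x y
  proof (rule has_sum_unique[OF has_sum_D])
    show "((\<lambda>l. l *\<^sub>R P l (x + y)) has_sum D x + D y) \<Lambda>"
      using has_sum_add[OF has_sum_D[of x] has_sum_D[of y]]
      by (rule has_sum_cong[THEN iffD1, rotated])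
        (simp add: linear_add bounded_linear_P bounded_linear.linear scaleR_add_right)
  qed
  have scale: "D (c *\<^sub>C x) = c *\<^sub>C D x" for c x
  proof (rule has_sum_unique[OF has_sum_D])
    have "bounded_linear (\<lambda>x::'a. c *\<^sub>C x)"
      by (rule bounded_linear_intro[of _ "cmod c"])
        (simp_all add: scaleC_add_right scaleR_scaleC complex_vector.scale_left_commute norm_scaleC mult.commute)
    from has_sum_bounded_linear[OF this has_sum_D[of x]]
    show "((\<lambda>l. l *\<^sub>R P l (c *\<^sub>C x)) has_sum c *\<^sub>C D x) \<Lambda>"
      by (rule has_sum_cong[THEN iffD1, rotated])
        (simp add: Pc scaleR_scaleC complex_vector.scale_left_commute)
  qed
  show "Vector_Spaces.linear scaleC scaleC D"
    by unfold_locales (simp_all add: add scale)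
  obtain b where b: "b > 0" "\<And>l. l \<in> \<Lambda> \<Longrightarrow> \<bar>l\<bar> \<le> b"
    using bdd by (auto simp: bounded_pos)
  have "norm (D x) \<le> b * norm x" for x
  proof (rule power2_le_imp_le)
    have "(norm (D x))\<^sup>2 \<le> b\<^sup>2 * (norm x)\<^sup>2"
    proof (rule has_sum_mono[OF has_sum_norm_P has_sum_cmult_right[OF has_sum_norm_P]])
      show "(norm (P l (D x)))\<^sup>2 \<le> b\<^sup>2 * (norm (P l x))\<^sup>2" if "l \<in> \<Lambda>" for l
        using b(2)[OF that] b(1) that
        by (simp add: P_D power_mult_distrib abs_le_square_iff[symmetric] mult_right_mono)
    qed
    then show "(norm (D x))\<^sup>2 \<le> (b * norm x)\<^sup>2" by (simp add: power_mult_distrib)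
  qed (use b in simp)
  then show "\<exists>C. \<forall>x. norm (D x) \<le> C * norm x" by blast
qed

text \<open>As \<open>D\<close>, \<open>F\<close> and \<open>K\<close> commute with the projections,
  \<open>S\<close> respects the splitting into components with index at most \<mu> and above \<mu>.
  Each part has its own gap, and the two combine because the parts and their images are
  orthogonal.\<close>

lemma gap_perturbation:
  assumes F: "bounded_clinear F" "finite_rank F" "\<And>l x. l \<in> \<Lambda> \<Longrightarrow> F (P l x) = P l (F x)"
    and K: "positive_op K" "compact_op K" "\<And>l x. l \<in> \<Lambda> \<Longrightarrow> K (P l x) = P l (K x)"
    and S: "\<And>x. S x = D x + F x - K x - \<mu> *\<^sub>R x"
    and sym: "\<And>x y. rinner (S x) y = rinner x (S y)"
    and \<delta>: "\<delta> > 0" "\<And>l. l \<in> \<Lambda> \<Longrightarrow> \<mu> < l \<Longrightarrow> \<mu> + \<delta> \<le> l"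
  shows "\<exists>C\<ge>0. \<forall>x. rinner (S x) x \<le> C * (norm (S x))\<^sup>2"
proof -
  have blF: "bounded_linear F" and blK: "bounded_linear K" and blD: "bounded_linear D"
    using F K bounded_clinear_D
    by (simp_all add: compact_op_def bounded_clinear_imp_bounded_linear)
  have S_eq: "S = (\<lambda>x. D x + F x - K x - \<mu> *\<^sub>R x)" using S by blast
  have blS: "bounded_linear S"
    unfolding S_eq
    by (intro bounded_linear_sub bounded_linear_add blF blK blD bounded_linear_scaleR_right)
  interpret S: bounded_linear S by fact
  define J where "J = {l\<in>\<Lambda>. \<mu> < l}"
  have J: "J \<subseteq> \<Lambda>" "\<Lambda> - J \<subseteq> \<Lambda>" by (auto simp: J_def)
  \<comment> \<open>\<open>H1\<close> holds the vectors with components only at indices at most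
    \<mu>, \<open>H2\<close> those with components only above \<mu>.\<close>
  define H1 where "H1 = {x. \<forall>l\<in>J. P l x = 0}"
  define H2 where "H2 = {x. \<forall>l\<in>\<Lambda> - J. P l x = 0}"
  note sub1 = closed_subspace_P_eq_0[OF J(1), folded H1_def]
  note sub2 = closed_subspace_P_eq_0[OF J(2), folded H2_def]
  have PS: "P l (S x) = 0" if l: "l \<in> \<Lambda>" and 0: "P l x = 0" for l x
  proof -
    interpret P: bounded_linear "P l" using l by (rule bounded_linear_P)
    have "P l (F x) = 0" "P l (K x) = 0" "P l (D x) = 0"
      using F(3)[OF l, of x] K(3)[OF l, of x] P_D[OF l, of x] 0 blF blK
      by (simp_all add: bounded_linear.linear linear_0)
    then show ?thesis using 0 by (simp add: S P.add P.diff P.scaleR)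
  qed
  have "\<exists>C\<ge>0. \<forall>x\<in>H1. rinner (S x) x \<le> C * (norm (S x))\<^sup>2"
  proof (rule symmetric_gap_finite_rank[OF blS sym F(2) sub1(1)])
    \<comment> \<open>On \<open>H1\<close>, \<open>D \<le> \<mu>\<close> and
      \<open>K \<ge> 0\<close>, hence \<open>S \<le> F\<close>.\<close>
    show "rinner (S x) x \<le> rinner (F x) x" if "x \<in> H1" for x
    proof -
      have "rinner (D x) x \<le> \<mu> * (norm x)\<^sup>2"
        by (rule D_upper) (use that in \<open>auto simp: H1_def J_def\<close>)
      then show ?thesis
        using positive_op_nonneg[OF K(1), of x] by (simp add: S rinner_algebra)
    qed
  qed
  then obtain C1 where C1: "C1 \<ge> 0" "\<And>x. x \<in> H1 \<Longrightarrow> rinner (S x) x \<le> C1 * (norm (S x))\<^sup>2"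
    by blast
  \<comment> \<open>Here \<open>D - \<mu> \<ge> \<delta>\<close>, and \<open>F\<close> joins
    \<open>K\<close> in the compact perturbation \<open>K - F\<close>.\<close>
  have "\<exists>C\<ge>0. \<forall>x\<in>H2. rinner (S x) x \<le> C * (norm (S x))\<^sup>2"
  proof (rule symmetric_gap_compact_perturbation[OF blS sym sub2])
    show "linear (\<lambda>x. D x - \<mu> *\<^sub>R x)"
      by (intro bounded_linear.linear bounded_linear_sub blD bounded_linear_scaleR_right)
    show "\<delta> > 0" by fact
    show "\<delta> * (norm x)\<^sup>2 \<le> rinner (D x - \<mu> *\<^sub>R x) x" if "x \<in> H2" for x
    proof -
      \<comment> \<open>By the choice of \<delta> an index below \<mu> + \<delta> lies outside
        \<open>J\<close>, so its component vanishes on \<open>H2\<close>.\<close>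
      have "(\<mu> + \<delta>) * (norm x)\<^sup>2 \<le> rinner (D x) x"
        by (rule D_lower) (use that \<delta> in \<open>force simp: H2_def J_def\<close>)
      then show ?thesis by (simp add: rinner_algebra algebra_simps)
    qed
    show "S x = (D x - \<mu> *\<^sub>R x) - (K x - F x)" for x
      by (simp add: S)
    show "\<exists>r::nat\<Rightarrow>nat. strict_mono r \<and> convergent (\<lambda>n. K (y (r n)) - F (y (r n)))"
      if y: "\<And>n. norm (y n) \<le> 1" for y
    proof -
      \<comment> \<open>Nested subsequences: \<open>r1\<close> makes the images under
        \<open>K\<close> converge, then \<open>r2\<close> those under \<open>F\<close> along
        \<open>r1\<close>.\<close>
      have "\<forall>n. K (y n) \<in> closure (K ` cball 0 1)"
        using y by (intro allI closure_subset[THEN subsetD] imageI) simp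
      then obtain l1 and r1 :: "nat \<Rightarrow> nat" where r1: "strict_mono r1" "((\<lambda>n. K (y n)) \<circ> r1) \<longlonglongrightarrow> l1"
        using K(2) unfolding compact_op_def compact_def by metis
      obtain c where c: "\<And>x. norm (F x) \<le> norm x * c" "c > 0"
        using bounded_linear.pos_bounded[OF blF] by blast
      obtain B where B: "finite B" "range F = complex_vector.span B"
        using F(2) by (auto simp: finite_rank_def finite_dim_def)
      have "norm (F (y n)) \<le> c" for n
      proof -
        have "norm (y n) * c \<le> 1 * c" using y c by (intro mult_right_mono) auto
        then show ?thesis using c(1)[of "y n"] by simp
      qed
      then obtain r2 l2 where r2: "strict_mono (r2::nat\<Rightarrow>nat)" "((\<lambda>n. F (y (r1 n))) \<circ> r2) \<longlonglongrightarrow> l2"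
        using finite_rank_convergent_subseq[OF B(1), of "\<lambda>n. F (y (r1 n))" c] B(2) by blast
      have "(\<lambda>n. K (y (r1 (r2 n)))) \<longlonglongrightarrow> l1"
        using LIMSEQ_subseq_LIMSEQ[OF r1(2) r2(1)] by (simp add: o_def)
      then have "(\<lambda>n. K (y (r1 (r2 n))) - F (y (r1 (r2 n)))) \<longlonglongrightarrow> l1 - l2"
        using r2(2) by (intro tendsto_diff) (simp_all add: o_def)
      then have "convergent (\<lambda>n. K (y ((r1 \<circ> r2) n)) - F (y ((r1 \<circ> r2) n)))"
        by (auto simp: convergent_def)
      moreover have "strict_mono (r1 \<circ> r2)"
        using r1 r2 by (simp add: strict_mono_o)
      ultimately show ?thesis by blast
    qed
  qed
  then obtain C2 where C2: "C2 \<ge> 0" "\<And>x. x \<in> H2 \<Longrightarrow> rinner (S x) x \<le> C2 * (norm (S x))\<^sup>2"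
    by blast
  define C where "C = max C1 C2"
  have "rinner (S x) x \<le> C * (norm (S x))\<^sup>2" for x
  proof -
    obtain v u where x: "x = v + u" "\<And>l. l \<in> \<Lambda> - J \<Longrightarrow> P l v = 0" "\<And>l. l \<in> J \<Longrightarrow> P l u = 0"
      using split[OF J(1), of x] by blast
    have uv: "u \<in> H1" "v \<in> H2" using x by (auto simp: H1_def H2_def)
    \<comment> \<open>Each projection annihilates \<open>u\<close> or \<open>v\<close>, hence by
      \<open>PS\<close> also its image under \<open>S\<close>, so all mixed terms vanish.\<close>
    have P0: "P l (S u) = 0 \<or> P l v = 0" "P l (S v) = 0 \<or> P l u = 0" "P l (S u) = 0 \<or> P l (S v) = 0"
      if "l \<in> \<Lambda>" for l
      using that x(2,3)[of l] PS[of l] by blast+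
    have o: "rinner (S u) v = 0" "rinner (S v) u = 0" "rinner (S u) (S v) = 0"
      using P0 by (auto intro: rinner_eq_0)
    have "rinner (S x) x = rinner (S u) u + rinner (S v) v"
      using o by (simp add: x S.add rinner_algebra)
    also have "\<dots> \<le> C1 * (norm (S u))\<^sup>2 + C2 * (norm (S v))\<^sup>2"
      using C1 C2 uv by (intro add_mono) auto
    also have "\<dots> \<le> C * (norm (S u))\<^sup>2 + C * (norm (S v))\<^sup>2"
      by (intro add_mono mult_right_mono) (simp_all add: C_def)
    also have "\<dots> = C * (norm (S x))\<^sup>2"
      using o(3) rinner_commute[of "S v" "S u"]
      by (simp add: x S.add rinner_self[symmetric] rinner.add_left rinner.add_right algebra_simps)
    finally show ?thesis .
  qed
  moreover have "C \<ge> 0" using C1 by (simp add: C_def)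
  ultimately show ?thesis by blast
qed

end

text \<open>If some element of \<Lambda> exceeds \<mu>, there is a least such element, and its
  distance to \<mu> serves as \<delta>; otherwise any positive \<delta> will do.\<close>

lemma well_order_gap_above:
  fixes \<mu> :: real
  assumes "well_order_on \<Lambda> {(l, m). l \<in> \<Lambda> \<and> m \<in> \<Lambda> \<and> l \<le> m}"
  shows "\<exists>\<delta>>0. \<forall>l\<in>\<Lambda>. \<mu> < l \<longrightarrow> \<mu> + \<delta> \<le> l"
proof (cases "\<exists>l\<in>\<Lambda>. \<mu> < l")
  case True
  have wf: "wf ({(l, m). l \<in> \<Lambda> \<and> m \<in> \<Lambda> \<and> l \<le> m} - Id)"
    using assms by (simp add: well_order_on_def)
  obtain l where "l \<in> {l\<in>\<Lambda>. \<mu> < l}"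
    using True by blast
  then obtain m where m: "m \<in> {l\<in>\<Lambda>. \<mu> < l}"
      "\<And>l. (l, m) \<in> {(l, m). l \<in> \<Lambda> \<and> m \<in> \<Lambda> \<and> l \<le> m} - Id \<Longrightarrow> l \<notin> {l\<in>\<Lambda>. \<mu> < l}"
    by (rule wfE_min[OF wf]) blast
  have "m \<le> l" if "l \<in> \<Lambda>" "\<mu> < l" for l
    using m(1) m(2)[of l] that by force
  then show ?thesis
    using m(1) by (intro exI[of _ "m - \<mu>"]) simp
qed (auto intro: exI[of _ 1])

theorem theorem5p4:
  fixes \<Lambda> :: "real set"
    and P :: "real \<Rightarrow> 'a::complex_hilbert_space \<Rightarrow> 'a"
    and F K T :: "'a \<Rightarrow> 'a"
  assumes "\<not> finite_dim (UNIV :: 'a set)"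
    and "separable_space (euclidean :: 'a topology)"
    and "\<Lambda> \<subseteq> {0..}" and "bounded \<Lambda>" and "countable \<Lambda>"
    and "well_order_on \<Lambda> {(l, m). l \<in> \<Lambda> \<and> m \<in> \<Lambda> \<and> l \<le> m}"
    and "\<And>l. l \<in> \<Lambda> \<Longrightarrow> orth_projection (P l)"
    and "\<And>l m x. l \<in> \<Lambda> \<Longrightarrow> m \<in> \<Lambda> \<Longrightarrow> l \<noteq> m \<Longrightarrow> P l (P m x) = 0"
    and "has_sot_sum P \<Lambda> (\<lambda>x. x)"
    and "bounded_clinear F" and "self_adjoint F" and "finite_rank F"
    and "bounded_clinear K" and "positive_op K" and "compact_op K"
    and "\<And>l x. l \<in> \<Lambda> \<Longrightarrow> F (P l x) = P l (F x)"
    and "\<And>l x. l \<in> \<Lambda> \<Longrightarrow> K (P l x) = P l (K x)"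
    and "\<And>l. l \<in> \<Lambda> \<Longrightarrow> op_le_on (range (P l)) K (\<lambda>x. l *\<^sub>R x)"
    and "T = (\<lambda>x. sot_sum (\<lambda>l x. l *\<^sub>R P l x) \<Lambda> x + F x - K x)"
    and "positive_op T"
  shows "T \<in> Mr"
proof -
  define D where "D = sot_sum (\<lambda>l x. l *\<^sub>R P l x) \<Lambda>"
  interpret orthogonal_resolution \<Lambda> P
    by unfold_locales (fact assms)+
  interpret diagonal_operator \<Lambda> P D
    using has_sot_sum_scaled_projections[OF \<open>bounded \<Lambda>\<close> proj orth sums_id] \<open>bounded \<Lambda>\<close>
    by unfold_locales (simp_all add: has_sot_sum_def D_def)
  have T: "T x = D x + F x - K x" for x
    using assms(19) by (simp add: D_def)
  have bT: "bounded_clinear T"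
    unfolding bounded_clinear_def
  proof
    have lin: "Vector_Spaces.linear scaleC scaleC A" if "bounded_clinear A" for A :: "'a \<Rightarrow> 'a"
      using that by (simp add: bounded_clinear_def)
    interpret D: Vector_Spaces.linear scaleC scaleC D by (rule lin) (rule bounded_clinear_D)
    interpret F: Vector_Spaces.linear scaleC scaleC F by (rule lin) fact
    interpret K: Vector_Spaces.linear scaleC scaleC K by (rule lin) fact
    show "Vector_Spaces.linear scaleC scaleC T"
      by unfold_locales (simp_all add: T D.add F.add K.add D.scale F.scale K.scale
          complex_vector.scale_right_distrib complex_vector.scale_right_diff_distrib)
    have "bounded_linear (\<lambda>x. D x + F x - K x)"
      using assms bounded_clinear_D
      by (intro bounded_linear_sub bounded_linear_add bounded_clinear_imp_bounded_linear)
    then show "\<exists>C. \<forall>x. norm (T x) \<le> C * norm x"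
      using bounded_linear.bounded[of "\<lambda>x. D x + F x - K x"] by (auto simp: T mult.commute)
  qed
  \<comment> \<open>The gap is established on all of H and at every real \<mu>, because the value of
    \<mu> to be used depends on the reducing subspace.\<close>
  have gap: "\<exists>C\<ge>0. \<forall>x. rinner (T x - \<mu> *\<^sub>R x) x \<le> C * (norm (T x - \<mu> *\<^sub>R x))\<^sup>2" for \<mu>
  proof -
    obtain \<delta> where \<delta>: "\<delta> > 0" "\<And>l. l \<in> \<Lambda> \<Longrightarrow> \<mu> < l \<Longrightarrow> \<mu> + \<delta> \<le> l"
      using well_order_gap_above[OF assms(6), of \<mu>] by blast
    have sym: "rinner (T x - \<mu> *\<^sub>R x) y = rinner x (T y - \<mu> *\<^sub>R y)" for x y
      using positive_op_symmetric[OF bT \<open>positive_op T\<close>] by (simp add: rinner_algebra)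
    show ?thesis
      by (rule gap_perturbation[OF assms(10,12,16,14,15,17) _ sym \<delta>]) (simp_all add: T)
  qed
  have "minimum_attaining T M" if M: "M \<noteq> {0}" "reduces M T" for M
  proof (rule minimum_attaining_if_gap[OF bT \<open>positive_op T\<close> gap])
    have "complex_vector.subspace M" using M by (simp add: reduces_def)
    then show "subspace M"
      by (simp add: subspace_def complex_vector.subspace_def scaleR_scaleC)
  qed (use M in \<open>auto simp: reduces_def\<close>)
  with bT show ?thesis by (simp add: Mr_def)
qed

end
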